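(* Let $\mu_{1},\mu_{2}$ be Borel probability measures on $\mathbb{R}$, and let $\alpha<\beta$ be real numbers. If $\alpha$ and $\beta$ are atoms of the free additive convolution $\mu_{1}\boxplus\mu_{2}$ (that is, $(\mu_1\boxplus\mu_2)(\{\alpha\})>0$ and $(\mu_1\boxplus\mu_2)(\{\beta\})>0$), and $(\mu_{1}\boxplus\mu_{2})((\alpha,\beta))=0$, then either $\mu_{1}$ or $\mu_{2}$ is a point mass.
   Context: A point mass is a measure $\delta_t$ (unit mass at a single point $t$). For a Borel probability measure $\mu$ on $\mathbb{R}$ set $$G_{\mu}(z)=\int_{-\infty}^{\infty}\frac{1}{z-t}\,d\mu(t),\qquad z\in\mathbb{C}^{+}=\{z\in\mathbb{C}:\Im z>0\}.$$ For $w$ in a Stolz angle $\{w\in\mathbb{C}^-: |\Re w|<-\Im w<\varepsilon\}$ at zero, with $\varepsilon>0$ small enough, $G_{\mu}$ has an analytic inverse with respect to composition, denoted $G_\mu^{-1}(w)$ (the branch with values in $\mathbb{C}^+$ satisfying $wG_\mu^{-1}(w)\to 1$ as $w\to0$ in the angle). The free additive convolution $\mu_1\boxplus\mu_2$ is the distribution of the sum of two freely independent selfadjoint random variables with distributions $\mu_1$ and $\mu_2$. Equivalently, it is the unique Borel probability measure on $\mathbb{R}$ such that $$G_{\mu_{1}\boxplus\mu_{2}}^{-1}(w)=G_{\mu_{1}}^{-1}(w)+G_{\mu_{2}}^{-1}(w)-\frac{1}{w}$$ for $w$ in some such Stolz angle. *)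

theory Defs
  imports "HOL-Probability.Probability"
begin

definition cauchy_transform :: "real measure \<Rightarrow> complex \<Rightarrow> complex" where
  "cauchy_transform \<mu> z = (LINT t|\<mu>. 1 / (z - complex_of_real t))"

definition stolz_angle :: "real \<Rightarrow> complex set" where
  "stolz_angle \<epsilon> = {w. \<bar>Re w\<bar> < - Im w \<and> - Im w < \<epsilon>}"

text \<open>
  The branch of the compositional inverse of the Cauchy transform on a Stolz angle is described
  by a predicate on functions \<open>g\<close>. The normalisation \<open>w * g w \<longlongrightarrow> 1\<close> pins it down: the Cauchy
  transform is injective near infinity in every nontangential cone, so two such functions agree
  near \<open>0\<close>, hence on the whole (connected) angle. Values of \<open>g\<close> off the angle are irrelevant.
\<close>
definition cauchy_inverse_on :: "real measure \<Rightarrow> real \<Rightarrow> (complex \<Rightarrow> complex) \<Rightarrow> bool" where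
  "cauchy_inverse_on \<mu> \<epsilon> g \<longleftrightarrow>
     g holomorphic_on stolz_angle \<epsilon> \<and>
     (\<forall>w\<in>stolz_angle \<epsilon>. Im (g w) > 0 \<and> cauchy_transform \<mu> (g w) = w) \<and>
     ((\<lambda>w. w * g w) \<longlongrightarrow> 1) (at 0 within stolz_angle \<epsilon>)"

text \<open>
  \<open>is_free_additive_convolution \<mu>\<^sub>1 \<mu>\<^sub>2 \<nu>\<close> says that \<open>\<nu>\<close> is the free additive convolution of
  \<open>\<mu>\<^sub>1\<close> and \<open>\<mu>\<^sub>2\<close>. It is a relation rather than an operation so that the classical theorem that
  exactly one such \<open>\<nu>\<close> exists is not built into the definition. Since the inverse branches are
  unique, it makes no difference that they are quantified existentially.
\<close>
definition is_free_additive_convolution ::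
    "real measure \<Rightarrow> real measure \<Rightarrow> real measure \<Rightarrow> bool" where
  "is_free_additive_convolution \<mu>\<^sub>1 \<mu>\<^sub>2 \<nu> \<longleftrightarrow>
     real_distribution \<nu> \<and>
     (\<exists>\<epsilon>>0. \<exists>g\<^sub>1 g\<^sub>2 g.
        cauchy_inverse_on \<mu>\<^sub>1 \<epsilon> g\<^sub>1 \<and> cauchy_inverse_on \<mu>\<^sub>2 \<epsilon> g\<^sub>2 \<and> cauchy_inverse_on \<nu> \<epsilon> g \<and>
        (\<forall>w\<in>stolz_angle \<epsilon>. g w = g\<^sub>1 w + g\<^sub>2 w - 1 / w))"

definition is_point_mass :: "real measure \<Rightarrow> bool" where
  "is_point_mass \<mu> \<longleftrightarrow> (\<exists>t. \<mu> = return borel t)"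

end

theory Submission
  imports Defs "HOL-Complex_Analysis.Complex_Analysis"
begin

text \<open>
  By subordination there are analytic self-maps \<open>\<omega>\<^sub>1\<close>, \<open>\<omega>\<^sub>2\<close> of the upper half-plane with
  \<open>G\<^bsub>\<mu>\<^sub>j\<^esub> \<circ> \<omega>\<^sub>j = G\<^sub>\<nu>\<close> and \<open>\<omega>\<^sub>1(z) + \<omega>\<^sub>2(z) = z + 1 / G\<^sub>\<nu>(z)\<close>. At an atom \<open>\<gamma>\<close> of \<open>\<nu>\<close> they have real
  boundary values \<open>a(\<gamma>)\<close>, \<open>b(\<gamma>)\<close> with \<open>a(\<gamma>) + b(\<gamma>) = \<gamma>\<close> and
  \<open>\<mu>\<^sub>1{a(\<gamma>)} + \<mu>\<^sub>2{b(\<gamma>)} = 1 + \<nu>{\<gamma>} > 1\<close>. Applying this at \<open>\<alpha>\<close> and \<open>\<beta>\<close>, the total mass forces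
  \<open>a(\<alpha>) = a(\<beta>)\<close> or \<open>b(\<alpha>) = b(\<beta>)\<close>; say the former. On the gap \<open>(\<alpha>, \<beta>)\<close> the function \<open>G\<^sub>\<nu>\<close> is
  real with one zero \<open>x\<^sub>0\<close>, and \<open>\<omega>\<^sub>1\<close> extends to a real increasing function with at most a simple
  pole, at \<open>x\<^sub>0\<close>. Having equal values at both ends of the gap, it must have that pole, so it takes
  every real value except \<open>a(\<alpha>)\<close> in the gap, and \<open>\<integral> |u - t|\<^sup>-\<^sup>2 d\<mu>\<^sub>1(t) \<le> \<integral> |x - t|\<^sup>-\<^sup>2 d\<nu>(t)\<close> for
  \<open>u = \<omega>\<^sub>1(x)\<close> shows that \<open>\<mu>\<^sub>1\<close> has no mass off \<open>a(\<alpha>)\<close>.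
\<close>

section \<open>Cauchy transforms\<close>

text \<open>The obstacle is that an analytic self-map of the half-plane need not have boundary
  values at a prescribed real point. All control comes from one quotient: with
  \<open>cauchy_energy\<close> for the integral of |z - t|^-2, one has Im (1 / G(z)) / Im z = energy
  / |G(z)|^2. Neither subordination function lowers imaginary parts, so the relation for their sum
  bounds the imaginary part of each of them by that of 1 / G for \<nu>. Hence a bound on the
  quotient for \<nu> alone bounds Im \<omega>(z) / Im z for both, and the Schwarz-Pick inequality
  turns this into a Lipschitz bound that persists up to the real axis. Such bounds are available
  where they are needed: near an atom on the side of the gap, where |G| is comparable to the
  reciprocal distance from the atom, and inside the gap off the zero of G, with a weight that blows
  up at this zero.\<close>

definition cauchy_energy :: "real measure \<Rightarrow> complex \<Rightarrow> real" where
  "cauchy_energy M z = (LINT t|M. 1 / (cmod (z - complex_of_real t))\<^sup>2)"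

context real_distribution
begin

lemma prob_UNIV: "prob UNIV = 1"
  using prob_space by simp

text \<open>The distance is bounded below only almost everywhere, so that the same facts serve
  points of the upper half-plane, with \<open>Im z\<close> as the bound, and real points inside the
  gap.\<close>

lemma integrable_cauchy_kernel:
  assumes "\<delta> > 0" "AE t in M. \<delta> \<le> cmod (z - of_real t)"
  shows "integrable M (\<lambda>t. 1 / (z - complex_of_real t))"
proof (rule integrable_const_bound[where B="1/\<delta>"])
  show "AE t in M. cmod (1 / (z - complex_of_real t)) \<le> 1 / \<delta>"
    using assms(2) by eventually_elim (use assms(1) in \<open>auto simp: norm_divide intro!: divide_left_mono mult_pos_pos\<close>)
qed simp

lemma integrable_cauchy_kernel_mult:
  assumes "\<delta> > 0" "AE t in M. \<delta> \<le> cmod (z - of_real t)"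
    and "\<epsilon> > 0" "AE t in M. \<epsilon> \<le> cmod (w - of_real t)"
  shows "integrable M (\<lambda>t. 1 / ((z - complex_of_real t) * (w - complex_of_real t)))"
    and "cmod (LINT t|M. 1 / ((z - complex_of_real t) * (w - complex_of_real t))) \<le> 1 / (\<delta> * \<epsilon>)"
proof -
  have bound: "AE t in M. cmod (1 / ((z - complex_of_real t) * (w - complex_of_real t))) \<le> 1 / (\<delta> * \<epsilon>)"
    using assms(2,4)
  proof eventually_elim
    case (elim t)
    have "\<delta> * \<epsilon> \<le> cmod (z - of_real t) * cmod (w - of_real t)"
      using elim assms(1,3) by (intro mult_mono) auto
    moreover have "0 < \<delta> * \<epsilon>" using assms(1,3) by simp
    ultimately show ?case
      by (auto simp: norm_divide norm_mult intro!: divide_left_mono mult_pos_pos)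
  qed
  show int: "integrable M (\<lambda>t. 1 / ((z - complex_of_real t) * (w - complex_of_real t)))"
    by (rule integrable_const_bound[OF bound]) simp
  have "cmod (LINT t|M. 1 / ((z - complex_of_real t) * (w - complex_of_real t)))
      \<le> (LINT t|M. cmod (1 / ((z - complex_of_real t) * (w - complex_of_real t))))"
    by (rule integral_norm_bound)
  also have "\<dots> \<le> (LINT t|M. 1 / (\<delta> * \<epsilon>))"
    by (rule integral_mono_AE) (use int bound in auto)
  finally show "cmod (LINT t|M. 1 / ((z - complex_of_real t) * (w - complex_of_real t))) \<le> 1 / (\<delta> * \<epsilon>)"
    by (simp add: prob_UNIV)
qed

lemma integrable_cauchy_energy:
  assumes "\<delta> > 0" "AE t in M. \<delta> \<le> cmod (z - of_real t)"
  shows "integrable M (\<lambda>t. 1 / (cmod (z - complex_of_real t))\<^sup>2)"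
    and "cauchy_energy M z \<le> 1 / \<delta>\<^sup>2"
proof -
  have bound: "AE t in M. 1 / (cmod (z - complex_of_real t))\<^sup>2 \<le> 1 / \<delta>\<^sup>2"
    using assms(2) by eventually_elim (use assms(1) in \<open>auto simp: intro!: divide_left_mono mult_pos_pos power_mono zero_less_power\<close>)
  show int: "integrable M (\<lambda>t. 1 / (cmod (z - complex_of_real t))\<^sup>2)"
    by (rule integrable_const_bound[where B="1/\<delta>\<^sup>2"]) (use bound in auto)
  have "cauchy_energy M z \<le> (LINT t|M. 1 / \<delta>\<^sup>2)"
    unfolding cauchy_energy_def by (rule integral_mono_AE) (use int bound in auto)
  then show "cauchy_energy M z \<le> 1 / \<delta>\<^sup>2"
    by (simp add: prob_UNIV)
qed

text \<open>The resolvent identity for the kernel, integrated. It yields differentiability,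
  Lipschitz bounds, and the factor \<open>x0 - z\<close> of the transform at a zero
  \<open>x0\<close>.\<close>

lemma cauchy_transform_diff:
  assumes "\<delta> > 0" "AE t in M. \<delta> \<le> cmod (z - of_real t)"
    and "\<epsilon> > 0" "AE t in M. \<epsilon> \<le> cmod (w - of_real t)"
  shows "cauchy_transform M z - cauchy_transform M w =
           (w - z) * (LINT t|M. 1 / ((z - complex_of_real t) * (w - complex_of_real t)))"
proof -
  have "cauchy_transform M z - cauchy_transform M w = (LINT t|M. 1 / (z - complex_of_real t) - 1 / (w - complex_of_real t))"
    unfolding cauchy_transform_def using assms
    by (intro Bochner_Integration.integral_diff[symmetric] integrable_cauchy_kernel) auto
  also have "\<dots> = (LINT t|M. (w - z) * (1 / ((z - complex_of_real t) * (w - complex_of_real t))))"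
  proof (rule integral_cong_AE)
    show "AE t in M. 1 / (z - complex_of_real t) - 1 / (w - complex_of_real t) =
        (w - z) * (1 / ((z - complex_of_real t) * (w - complex_of_real t)))"
      using assms(2,4)
    proof eventually_elim
      case (elim t)
      then have "z - of_real t \<noteq> 0" "w - of_real t \<noteq> 0" using assms(1,3) by auto
      then show ?case by (simp add: field_simps)
    qed
  qed auto
  finally show ?thesis by (simp only: integral_mult_right_zero)
qed

lemma cauchy_transform_lipschitz:
  assumes "\<delta> > 0" "AE t in M. \<delta> \<le> cmod (z - of_real t)"
    and "\<epsilon> > 0" "AE t in M. \<epsilon> \<le> cmod (w - of_real t)"
  shows "cmod (cauchy_transform M z - cauchy_transform M w) \<le> cmod (z - w) / (\<delta> * \<epsilon>)"
  using mult_left_mono[OF integrable_cauchy_kernel_mult(2)[OF assms], of "cmod (z - w)"]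
  by (simp add: cauchy_transform_diff[OF assms] norm_mult norm_minus_commute)

lemma AE_Im_le:
  assumes "Im z > 0"
  shows "AE t in M. Im z \<le> cmod (z - of_real t)"
  using abs_Im_le_cmod[of "z - of_real _"] assms by (auto intro!: AE_I2)

lemmas upper_integrable_kernel = integrable_cauchy_kernel[OF _ AE_Im_le]
lemmas upper_integrable_energy = integrable_cauchy_energy[OF _ AE_Im_le]

lemma Im_cauchy_transform:
  assumes "Im z > 0"
  shows "Im (cauchy_transform M z) = - (Im z * cauchy_energy M z)"
proof -
  have "Im (cauchy_transform M z) = (LINT t|M. Im (1 / (z - complex_of_real t)))"
    unfolding cauchy_transform_def using upper_integrable_kernel[OF assms assms] by simp
  also have "\<dots> = (LINT t|M. (- Im z) * (1 / (cmod (z - complex_of_real t))\<^sup>2))"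
    by (intro Bochner_Integration.integral_cong) (auto simp: Im_divide cmod_power2)
  also have "\<dots> = - Im z * cauchy_energy M z"
    unfolding cauchy_energy_def by (rule integral_mult_right_zero)
  finally show ?thesis by simp
qed

lemma Re_cauchy_transform:
  assumes "Im z > 0"
  shows "Re (cauchy_transform M z) = (LINT t|M. (Re z - t) / (cmod (z - complex_of_real t))\<^sup>2)"
    and "integrable M (\<lambda>t. (Re z - t) / (cmod (z - complex_of_real t))\<^sup>2)"
proof -
  have eq: "(\<lambda>t. Re (1 / (z - complex_of_real t))) = (\<lambda>t. (Re z - t) / (cmod (z - complex_of_real t))\<^sup>2)"
    by (auto simp: Re_divide cmod_power2)
  show "integrable M (\<lambda>t. (Re z - t) / (cmod (z - complex_of_real t))\<^sup>2)"
    using integrable_Re[OF upper_integrable_kernel[OF assms assms]] unfolding eq .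
  show "Re (cauchy_transform M z) = (LINT t|M. (Re z - t) / (cmod (z - complex_of_real t))\<^sup>2)"
    unfolding cauchy_transform_def using upper_integrable_kernel[OF assms assms]
    by (simp flip: integral_Re add: eq)
qed

lemma cauchy_energy_atom:
  assumes "Im z > 0"
  shows "measure M {a} / (cmod (z - of_real a))\<^sup>2 \<le> cauchy_energy M z"
proof -
  have "measure M {a} / (cmod (z - of_real a))\<^sup>2 = (LINT t|M. indicator {a} t * (1 / (cmod (z - of_real a))\<^sup>2))"
    by simp
  also have "\<dots> \<le> cauchy_energy M z"
    unfolding cauchy_energy_def
    using upper_integrable_energy(1)[OF assms assms]
    by (intro integral_mono integrable_mult_left integrable_real_indicator) (auto split: split_indicator simp: emeasure_eq_measure)
  finally show ?thesis .
qed

text \<open>A Chebyshev estimate: on the interval the integrand of the energy is at least the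
  reciprocal of the squared factor on the right.\<close>

lemma cauchy_energy_Icc:
  assumes "Im z > 0" "\<delta> > 0"
  shows "measure M {u-\<delta>..u+\<delta>} \<le> cauchy_energy M z * (\<delta> + cmod (z - of_real u))\<^sup>2"
proof -
  let ?r = "\<delta> + cmod (z - of_real u)"
  have r: "?r > 0" using assms(2) by (simp add: add_pos_nonneg)
  have "measure M {u-\<delta>..u+\<delta>} / ?r\<^sup>2 = (LINT t|M. indicator {u-\<delta>..u+\<delta>} t * (1 / ?r\<^sup>2))"
    by simp
  also have "\<dots> \<le> cauchy_energy M z"
    unfolding cauchy_energy_def
  proof (intro integral_mono)
    fix t
    have "cmod (z - of_real t) > 0" using assms(1) by (auto simp: complex_eq_iff)
    moreover have "cmod (z - of_real t) \<le> ?r" if "t \<in> {u-\<delta>..u+\<delta>}"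
    proof -
      have "cmod (z - of_real t) \<le> cmod (z - of_real u) + cmod (of_real u - of_real t)"
        using norm_triangle_ineq[of "z - of_real u" "of_real u - of_real t"] by simp
      also have "cmod (of_real u - of_real t) = \<bar>u - t\<bar>"
        by (metis norm_of_real of_real_diff)
      finally show ?thesis using that by auto
    qed
    ultimately show "indicator {u-\<delta>..u+\<delta>} t * (1 / ?r\<^sup>2) \<le> 1 / (cmod (z - complex_of_real t))\<^sup>2"
      using r by (auto split: split_indicator intro!: divide_left_mono mult_pos_pos power_mono zero_less_power)
  qed (use upper_integrable_energy(1)[OF assms(1) assms(1)] in \<open>auto intro!: integrable_mult_left integrable_real_indicator simp: emeasure_eq_measure\<close>)
  finally show ?thesis using r by (simp add: pos_divide_le_eq)
qed

lemma cauchy_energy_pos: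
  assumes "Im z > 0"
  shows "cauchy_energy M z > 0"
proof -
  have "1 / (cmod (z - complex_of_real t))\<^sup>2 \<ge> 0" for t by simp
  moreover have "1 / (cmod (z - complex_of_real t))\<^sup>2 \<noteq> 0" for t using assms by (auto simp: complex_eq_iff)
  ultimately have "cauchy_energy M z \<noteq> 0"
    unfolding cauchy_energy_def
    by (subst integral_nonneg_eq_0_iff_AE[OF upper_integrable_energy(1)[OF assms assms]]) (auto simp: AE_False)
  moreover have "cauchy_energy M z \<ge> 0" unfolding cauchy_energy_def by simp
  ultimately show ?thesis by simp
qed

lemma cauchy_transform_nonzero: "Im z > 0 \<Longrightarrow> cauchy_transform M z \<noteq> 0"
  using Im_cauchy_transform[of z] cauchy_energy_pos[of z] by auto

lemma cauchy_transform_square_le_energy: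
  assumes "Im z > 0"
  shows "(cmod (cauchy_transform M z))\<^sup>2 \<le> cauchy_energy M z"
proof -
  define G where "G = cauchy_transform M z"
  note i = upper_integrable_kernel[OF assms assms] upper_integrable_energy(1)[OF assms assms]
  \<comment> \<open>The variance of the Cauchy kernel is nonnegative.\<close>
  have "0 \<le> (LINT t|M. (cmod (1 / (z - complex_of_real t) - G))\<^sup>2)" by simp
  also have "(\<lambda>t. (cmod (1 / (z - complex_of_real t) - G))\<^sup>2) =
     (\<lambda>t. 1 / (cmod (z - complex_of_real t))\<^sup>2 - 2 * Re (1 / (z - complex_of_real t) * cnj G) + (cmod G)\<^sup>2)"
  proof
    fix t
    have *: "(cmod (a - b))\<^sup>2 = (cmod a)\<^sup>2 - 2 * Re (a * cnj b) + (cmod b)\<^sup>2" for a b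
      unfolding cmod_power2 by (simp add: power2_eq_square algebra_simps)
    show "(cmod (1 / (z - complex_of_real t) - G))\<^sup>2 = 1 / (cmod (z - complex_of_real t))\<^sup>2
         - 2 * Re (1 / (z - complex_of_real t) * cnj G) + (cmod G)\<^sup>2"
      using *[of "1 / (z - complex_of_real t)" G] by (simp add: norm_divide power_divide)
  qed
  also have "(LINT t|M. 1 / (cmod (z - complex_of_real t))\<^sup>2 - 2 * Re (1 / (z - complex_of_real t) * cnj G) + (cmod G)\<^sup>2)
     = cauchy_energy M z - 2 * Re (G * cnj G) + (cmod G)\<^sup>2"
  proof -
    have j: "integrable M (\<lambda>t. 1 / (z - complex_of_real t) * cnj G)"
      using i(1) by (rule integrable_mult_left)
    have "(LINT t|M. Re (1 / (z - complex_of_real t) * cnj G)) = Re (LINT t|M. 1 / (z - complex_of_real t) * cnj G)"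
      using j by (rule integral_Re)
    also have "(LINT t|M. 1 / (z - complex_of_real t) * cnj G) = G * cnj G"
      unfolding G_def cauchy_transform_def by (simp only: integral_mult_left_zero)
    finally have k: "(LINT t|M. Re (1 / (z - complex_of_real t) * cnj G)) = Re (G * cnj G)" .
    have "(LINT t|M. 1 / (cmod (z - complex_of_real t))\<^sup>2 - 2 * Re (1 / (z - complex_of_real t) * cnj G) + (cmod G)\<^sup>2)
      = (LINT t|M. 1 / (cmod (z - complex_of_real t))\<^sup>2 - 2 * Re (1 / (z - complex_of_real t) * cnj G)) + (LINT t|M. (cmod G)\<^sup>2)"
      by (intro Bochner_Integration.integral_add Bochner_Integration.integrable_diff integrable_mult_right integrable_Re j i) simp
    also have "(LINT t|M. 1 / (cmod (z - complex_of_real t))\<^sup>2 - 2 * Re (1 / (z - complex_of_real t) * cnj G))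
      = cauchy_energy M z - (LINT t|M. 2 * Re (1 / (z - complex_of_real t) * cnj G))"
      unfolding cauchy_energy_def
      by (intro Bochner_Integration.integral_diff integrable_mult_right integrable_Re j i)
    also have "(LINT t|M. 2 * Re (1 / (z - complex_of_real t) * cnj G)) = 2 * Re (G * cnj G)"
      unfolding integral_mult_right_zero k ..
    finally show ?thesis by (simp add: prob_UNIV)
  qed
  also have "Re (G * cnj G) = (cmod G)\<^sup>2"
    unfolding cmod_power2 by (simp add: power2_eq_square)
  finally show ?thesis by (simp add: G_def)
qed

lemma Im_inverse_cauchy_transform:
  assumes "Im z > 0"
  shows "Im (1 / cauchy_transform M z) = Im z * cauchy_energy M z / (cmod (cauchy_transform M z))\<^sup>2"
proof -
  have "Im (1 / w) = - Im w / (cmod w)\<^sup>2" for w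
    unfolding cmod_power2 by (simp add: Im_divide)
  then show ?thesis by (simp add: Im_cauchy_transform[OF assms])
qed

text \<open>A form of the Cauchy-Schwarz inequality. It makes \<open>z + h(w)\<close>, with
  \<open>h(w) = 1 / G(w) - w\<close>, a map of the half-plane into itself for every \<open>z\<close>
  in it, which is what the fixed point construction of the subordination functions iterates.\<close>

lemma Im_le_Im_inverse_cauchy_transform:
  assumes "Im z > 0"
  shows "Im z \<le> Im (1 / cauchy_transform M z)"
  using cauchy_transform_square_le_energy[OF assms] cauchy_transform_nonzero[OF assms] assms
  by (simp add: Im_inverse_cauchy_transform[OF assms] pos_le_divide_eq mult_left_mono)

text \<open>By the resolvent identity the difference quotient at \<open>z\<close> is exactly
  \<open>- ?K z w\<close>, so only continuity of \<open>?K z\<close> at \<open>z\<close> is at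
  stake. For \<open>Im w > Im z / 2\<close> the difference of the integrands has three factors in
  its denominator, two of size at least \<open>Im z\<close> and one at least half of that, whence
  the constant \<open>2 / ?d ^ 3\<close>.\<close>

lemma cauchy_transform_holomorphic: "cauchy_transform M holomorphic_on {z. Im z > 0}"
proof -
  let ?K = "\<lambda>z w. LINT t|M. 1 / ((z - complex_of_real t) * (w - complex_of_real t))"
  have "(cauchy_transform M has_field_derivative - ?K z z) (at z)" if z: "Im z > 0" for z
  proof -
    let ?d = "Im z"
    have ev: "eventually (\<lambda>w. Im w > ?d / 2) (at z)"
      using z by (intro order_tendstoD[OF tendsto_Im[OF tendsto_ident_at]]) auto
    have "((\<lambda>w. ?K z w - ?K z z) \<longlongrightarrow> 0) (at z)"
    proof (rule Lim_null_comparison)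
      show "((\<lambda>w. cmod (w - z) * (2 / ?d ^ 3)) \<longlongrightarrow> 0) (at z)"
        by (rule tendsto_eq_intros refl)+ auto
      show "eventually (\<lambda>w. cmod (?K z w - ?K z z) \<le> cmod (w - z) * (2 / ?d ^ 3)) (at z)"
        using ev
      proof eventually_elim
        case (elim w)
        then have w: "Im w > 0" using z by simp
        have tz: "z - of_real t \<noteq> 0" "w - of_real t \<noteq> 0" for t
          using z w by (auto simp: complex_eq_iff)
        note I = integrable_cauchy_kernel_mult[OF z AE_Im_le[OF z] w AE_Im_le[OF w]]
          integrable_cauchy_kernel_mult[OF z AE_Im_le[OF z] z AE_Im_le[OF z]]
        have bound: "cmod (1 / ((z - complex_of_real t) * (w - complex_of_real t)) - 1 / ((z - complex_of_real t) * (z - complex_of_real t)))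
              \<le> cmod (w - z) * (2 / ?d ^ 3)" for t
        proof -
          have "1 / ((z - complex_of_real t) * (w - complex_of_real t)) - 1 / ((z - complex_of_real t) * (z - complex_of_real t))
            = (z - w) / ((z - of_real t) * (z - of_real t) * (w - of_real t))"
          proof -
            have *: "1 / (a * b) - 1 / (a * a) = (a - b) / (a * a * b)" if "a \<noteq> 0" "b \<noteq> 0" for a b :: complex
              using that by (simp add: divide_simps)
            have "z - w = (z - of_real t) - (w - of_real t)" by simp
            then show ?thesis using *[OF tz[of t]] by metis
          qed
          also have "cmod \<dots> = cmod (w - z) * (1 / (cmod (z - of_real t) * cmod (z - of_real t) * cmod (w - of_real t)))"
            by (simp add: norm_divide norm_mult norm_minus_commute)
          also have "\<dots> \<le> cmod (w - z) * (1 / (?d * ?d * (?d / 2)))"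
          proof (intro mult_left_mono divide_left_mono mult_mono)
            show "?d \<le> cmod (z - of_real t)" "?d \<le> cmod (z - of_real t)" using abs_Im_le_cmod[of "z - of_real t"] by auto
            show "?d / 2 \<le> cmod (w - of_real t)" using abs_Im_le_cmod[of "w - of_real t"] elim by auto
          qed (use z tz[of t] in auto)
          finally show ?thesis by (simp add: power3_eq_cube)
        qed
        let ?D = "\<lambda>t. 1 / ((z - complex_of_real t) * (w - complex_of_real t)) - 1 / ((z - complex_of_real t) * (z - complex_of_real t))"
        have "?K z w - ?K z z = integral\<^sup>L M ?D"
          using I by simp
        moreover have "cmod (integral\<^sup>L M ?D) \<le> (LINT t|M. cmod (w - z) * (2 / ?d ^ 3))"
          by (rule order_trans[OF integral_norm_bound integral_mono]) (use I bound in auto)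
        ultimately show ?case by (simp add: prob_UNIV)
      qed
    qed
    then have "((\<lambda>w. - ?K z w) \<longlongrightarrow> - ?K z z) (at z)"
      by (intro tendsto_minus) (simp add: LIM_zero_iff)
    moreover have "eventually (\<lambda>w. - ?K z w = (cauchy_transform M w - cauchy_transform M z) / (w - z)) (at z)"
      using ev eventually_neq_at_within[of z]
    proof eventually_elim
      case (elim w)
      then have w: "Im w > 0" using z by simp
      have "cauchy_transform M w - cauchy_transform M z = (w - z) * (- ?K z w)"
        using cauchy_transform_diff[OF z AE_Im_le[OF z] w AE_Im_le[OF w]] by (simp add: algebra_simps)
      then show ?case using elim by simp
    qed
    ultimately show ?thesis
      unfolding has_field_derivative_iff by (rule Lim_transform_eventually)
  qed
  then show ?thesis
    by (metis (no_types, lifting) field_differentiable_at_within field_differentiable_def holomorphic_on_def mem_Collect_eq)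
qed

text \<open>Dominated convergence: \<open>(w - a) / (w - t)\<close> tends to the indicator of
  \<open>{a}\<close>, and the cone condition bounds it by \<open>K\<close> because |w - t| is at
  least \<open>Im w\<close>. A general cone is allowed since the lemma is also applied along the
  image of a vertical sequence under a subordination function.\<close>

lemma cauchy_transform_atom_limit:
  fixes w :: "nat \<Rightarrow> complex" and a :: real
  assumes lim: "w \<longlonglongrightarrow> of_real a" and pos: "\<And>n. Im (w n) > 0"
    and cone: "\<And>n. cmod (w n - of_real a) \<le> K * Im (w n)"
  shows "(\<lambda>n. (w n - of_real a) * cauchy_transform M (w n)) \<longlonglongrightarrow> of_real (measure M {a})"
proof -
  have nz: "w n - of_real t \<noteq> 0" for n t using pos[of n] by (auto simp: complex_eq_iff)
  have "(\<lambda>n. LINT t|M. (w n - of_real a) / (w n - complex_of_real t)) \<longlonglongrightarrow> (LINT t|M. complex_of_real (indicator {a} t))"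
  proof (rule integral_dominated_convergence[where w="\<lambda>_. K"])
    show "AE t in M. (\<lambda>n. (w n - of_real a) / (w n - complex_of_real t)) \<longlonglongrightarrow> complex_of_real (indicator {a} t)"
    proof (rule AE_I2)
      fix t
      show "(\<lambda>n. (w n - of_real a) / (w n - complex_of_real t)) \<longlonglongrightarrow> complex_of_real (indicator {a} t)"
      proof (cases "t = a")
        case True then show ?thesis using nz[of _ a] by simp
      next
        case False
        have "(\<lambda>n. (w n - of_real a) / (w n - complex_of_real t)) \<longlonglongrightarrow> (of_real a - of_real a) / (of_real a - complex_of_real t)"
          by (intro tendsto_intros lim) (use False in auto)
        then show ?thesis using False by simp
      qed
    qed
    show "AE t in M. cmod ((w n - of_real a) / (w n - complex_of_real t)) \<le> K" for n
    proof (rule AE_I2)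
      fix t
      have "Im (w n) \<le> cmod (w n - of_real t)" using abs_Im_le_cmod[of "w n - of_real t"] by auto
      moreover have "0 \<le> K * Im (w n)" using cone[of n] norm_ge_zero order_trans by blast
      then have "0 \<le> K" using pos[of n] by (simp add: zero_le_mult_iff)
      ultimately have "cmod (w n - of_real a) \<le> K * cmod (w n - of_real t)"
        using cone[of n] by (meson mult_left_mono order_trans)
      then show "cmod ((w n - of_real a) / (w n - complex_of_real t)) \<le> K"
        using nz[of n t] by (simp add: norm_divide pos_divide_le_eq)
    qed
  qed auto
  moreover have "(LINT t|M. (w n - of_real a) / (w n - complex_of_real t)) = (w n - of_real a) * cauchy_transform M (w n)" for n
  proof -
    have "(LINT t|M. (w n - of_real a) * (1 / (w n - complex_of_real t))) = (w n - of_real a) * cauchy_transform M (w n)"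
      unfolding cauchy_transform_def by (rule integral_mult_right_zero)
    then show ?thesis by simp
  qed
  moreover have "(LINT t|M. complex_of_real (indicator {a} t)) = of_real (measure M {a})"
    by (simp only: integral_complex_of_real) simp
  ultimately show ?thesis by simp
qed

text \<open>Bounded energy along a sequence tending to \<open>u\<close> stands in for a finite
  integral of |u - t|^-2 at the real point itself; the Chebyshev estimate passes to the
  limit.\<close>

lemma measure_Icc_le_of_energy_bound:
  fixes w :: "nat \<Rightarrow> complex"
  assumes lim: "w \<longlonglongrightarrow> of_real u" and pos: "\<And>n. Im (w n) > 0"
    and bound: "\<And>n. cauchy_energy M (w n) \<le> C" and "\<delta> > 0"
  shows "measure M {u-\<delta>..u+\<delta>} \<le> C * \<delta>\<^sup>2"
proof (rule LIMSEQ_le_const)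
  have "(\<lambda>n. C * (\<delta> + cmod (w n - of_real u))\<^sup>2) \<longlonglongrightarrow> C * (\<delta> + cmod (of_real u - of_real u))\<^sup>2"
    by (intro tendsto_intros lim)
  then show "(\<lambda>n. C * (\<delta> + cmod (w n - of_real u))\<^sup>2) \<longlonglongrightarrow> C * \<delta>\<^sup>2" by simp
  show "\<exists>N. \<forall>n\<ge>N. measure M {u-\<delta>..u+\<delta>} \<le> C * (\<delta> + cmod (w n - of_real u))\<^sup>2"
    using cauchy_energy_Icc[OF pos \<open>\<delta> > 0\<close>] bound by (meson mult_right_mono order_trans zero_le_power2)
qed

text \<open>Cover the interval by \<open>n\<close> intervals of length \<open>O(1/n)\<close>, each of mass \<open>O(1/n\<^sup>2)\<close>.\<close>
lemma measure_Icc_eq_0: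
  assumes "p < q"
    and small: "\<And>u \<delta>. p \<le> u \<Longrightarrow> u \<le> q \<Longrightarrow> \<delta> > 0 \<Longrightarrow> measure M {u-\<delta>..u+\<delta>} \<le> C * \<delta>\<^sup>2"
  shows "measure M {p..q} = 0"
proof -
  have le: "measure M {p..q} \<le> C * (q - p)\<^sup>2 * (1 / real (Suc n))" for n
  proof -
    define N where "N = Suc n"
    define d where "d = (q - p) / N"
    define c where "c k = p + k * d" for k :: nat
    have N: "real N > 0" and d: "d > 0" using assms(1) by (auto simp: N_def d_def)
    have Nd: "N * d = q - p" using N by (simp add: d_def)
    have "{p..q} \<subseteq> (\<Union>k<N. {c k - d..c k + d})"
    proof
      fix x assume x: "x \<in> {p..q}"
      show "x \<in> (\<Union>k<N. {c k - d..c k + d})"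
      proof (cases "x = q")
        \<comment> \<open>At the right end the floor below would give the index \<open>N\<close>,
          just out of range, so this point is put into the last interval.\<close>
        case True
        have "c n + d = q" using Nd by (simp add: c_def N_def algebra_simps)
        then have "x \<in> {c n - d..c n + d}" using True d by auto
        then show ?thesis by (auto simp: N_def)
      next
        case False
        define k where "k = nat \<lfloor>(x - p) / d\<rfloor>"
        have nn: "(x - p) / d \<ge> 0" using x d by auto
        then have k: "real k \<le> (x - p) / d" "(x - p) / d < real k + 1"
          unfolding k_def by (simp_all add: of_nat_nat)
        have "(x - p) / d < N" using x False Nd d by (simp add: pos_divide_less_eq)
        then have "k < N" using k by linarith
        moreover have "k * d \<le> x - p" "x - p < (k + 1) * d"
          using k d by (simp_all add: pos_le_divide_eq pos_divide_less_eq algebra_simps)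
        then have "x \<in> {c k - d..c k + d}" using d by (auto simp: c_def algebra_simps)
        ultimately show ?thesis by blast
      qed
    qed
    then have "measure M {p..q} \<le> measure M (\<Union>k<N. {c k - d..c k + d})"
      by (intro finite_measure_mono) auto
    also have "\<dots> \<le> (\<Sum>k<N. measure M {c k - d..c k + d})"
      by (intro measure_UNION_le) auto
    also have "\<dots> \<le> (\<Sum>k<N. C * d\<^sup>2)"
    proof (rule sum_mono)
      fix k assume "k \<in> {..<N}"
      then have "k * d \<le> N * d" using d by (intro mult_right_mono) auto
      moreover have "0 \<le> k * d" using d by simp
      ultimately show "measure M {c k - d..c k + d} \<le> C * d\<^sup>2"
        using Nd d by (intro small) (auto simp: c_def)
    qed
    also have "\<dots> = C * (q - p)\<^sup>2 * (1 / N)"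
      using N by (simp add: d_def power2_eq_square field_simps)
    finally show ?thesis by (simp only: N_def)
  qed
  have "(\<lambda>n. C * (q - p)\<^sup>2 * (1 / real (Suc n))) \<longlonglongrightarrow> C * (q - p)\<^sup>2 * 0"
    by (intro tendsto_intros LIMSEQ_Suc[OF lim_1_over_n])
  then have "measure M {p..q} \<le> C * (q - p)\<^sup>2 * 0"
    by (rule LIMSEQ_le_const) (use le in auto)
  then show ?thesis by (simp add: measure_le_0_iff)
qed

end

section \<open>Subordination\<close>

text \<open>This compares the numerator and the denominator of the pseudohyperbolic distance, and so
  allows Schwarz-Pick to be stated without denominators.\<close>

lemma cmod_diff_cnj_square: "(cmod (z - cnj v))\<^sup>2 = (cmod (z - v))\<^sup>2 + 4 * (Im z * Im v)"
  unfolding cmod_power2 by (simp add: power2_eq_square algebra_simps)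

text \<open>Reduction to the Schwarz lemma on the disc: \<open>\<psi>\<close> is the inverse Cayley
  transform with \<open>\<psi> 0 = v\<close>, and \<open>\<phi>\<close> follows \<open>f\<close> by
  the Cayley transform that sends \<open>f v\<close> to 0. The point \<open>\<xi>\<close> is the
  preimage of \<open>u\<close>.\<close>

lemma Schwarz_Pick_open_half_plane:
  assumes hol: "f holomorphic_on {z. Im z > 0}" and pos: "\<And>z. Im z > 0 \<Longrightarrow> Im (f z) > 0"
    and u: "Im u > 0" and v: "Im v > 0"
  shows "(cmod (f u - f v))\<^sup>2 * (Im u * Im v) \<le> (cmod (u - v))\<^sup>2 * (Im (f u) * Im (f v))"
proof -
  define \<psi> where "\<psi> \<zeta> = (v - cnj v * \<zeta>) / (1 - \<zeta>)" for \<zeta>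
  define \<phi> where "\<phi> \<zeta> = (f (\<psi> \<zeta>) - f v) / (f (\<psi> \<zeta>) - cnj (f v))" for \<zeta>
  have lt: "cmod (x - y) < cmod (x - cnj y)" if "Im x > 0" "Im y > 0" for x y
    by (rule power2_less_imp_less) (use that in \<open>auto simp: cmod_diff_cnj_square\<close>)
  have ne: "x - cnj y \<noteq> 0" if "Im x > 0" "Im y > 0" for x y
    using that by (auto simp: complex_eq_iff)
  have \<psi>: "Im (\<psi> \<zeta>) > 0" if "cmod \<zeta> < 1" for \<zeta>
  proof -
    have n1: "1 - \<zeta> \<noteq> 0" using that by auto
    have a: "\<psi> \<zeta> - cnj v = (v - cnj v) / (1 - \<zeta>)" and b: "\<psi> \<zeta> - v = \<zeta> * (\<psi> \<zeta> - cnj v)"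
      using n1 by (auto simp: \<psi>_def field_simps)
    have "v - cnj v \<noteq> 0" using v by (auto simp: complex_eq_iff)
    then have "cmod (\<psi> \<zeta> - cnj v) > 0" using a n1 by auto
    then have "cmod (\<psi> \<zeta> - v) < cmod (\<psi> \<zeta> - cnj v)"
      unfolding b norm_mult using that by simp
    then have "(cmod (\<psi> \<zeta> - v))\<^sup>2 < (cmod (\<psi> \<zeta> - cnj v))\<^sup>2"
      by (intro power_strict_mono) auto
    then have "0 < Im (\<psi> \<zeta>) * Im v" by (simp add: cmod_diff_cnj_square mult.commute)
    then show ?thesis using v by (simp add: zero_less_mult_iff)
  qed
  define \<xi> where "\<xi> = (u - v) / (u - cnj v)"
  have n: "u - cnj v \<noteq> 0" by (rule ne[OF u v])
  have "cmod \<xi> < 1" using lt[OF u v] n by (simp add: \<xi>_def norm_divide)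
  have "1 - \<xi> = (v - cnj v) / (u - cnj v)" "v - cnj v * \<xi> = u * ((v - cnj v) / (u - cnj v))"
    using n by (auto simp: \<xi>_def field_simps)
  moreover have "v - cnj v \<noteq> 0" using v by (auto simp: complex_eq_iff)
  ultimately have \<psi>\<xi>: "\<psi> \<xi> = u" using n by (simp add: \<psi>_def)
  have hol\<psi>: "\<psi> holomorphic_on ball 0 1"
    unfolding \<psi>_def by (intro holomorphic_intros) auto
  have "(\<lambda>\<zeta>. f (\<psi> \<zeta>)) holomorphic_on ball 0 1"
    using holomorphic_on_compose_gen[OF hol\<psi> hol] \<psi> by (auto simp: o_def image_subset_iff)
  then have "\<phi> holomorphic_on ball 0 1"
    unfolding \<phi>_def by (intro holomorphic_intros) (use \<psi> ne pos v in auto)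
  moreover have "\<phi> 0 = 0" by (simp add: \<phi>_def \<psi>_def)
  moreover have "cmod (\<phi> \<zeta>) < 1" if "cmod \<zeta> < 1" for \<zeta>
    using lt[OF pos[OF \<psi>[OF that]] pos[OF v]]
    by (simp add: \<phi>_def norm_divide divide_less_eq_1)
  ultimately have "cmod (\<phi> \<xi>) \<le> cmod \<xi>"
    using \<open>cmod \<xi> < 1\<close> by (rule Schwarz_Lemma(1))
  then have "cmod (f u - f v) / cmod (f u - cnj (f v)) \<le> cmod (u - v) / cmod (u - cnj v)"
    by (simp add: \<phi>_def \<psi>\<xi> norm_divide) (simp add: \<xi>_def norm_divide)
  then have "cmod (f u - f v) * cmod (u - cnj v) \<le> cmod (u - v) * cmod (f u - cnj (f v))"
    using n ne[OF pos[OF u] pos[OF v]] by (simp add: field_simps)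
  \<comment> \<open>After squaring, both sides contain the product of |f u - f v|^2 and |u - v|^2,
    which cancels.\<close>
  then have "(cmod (f u - f v) * cmod (u - cnj v))\<^sup>2 \<le> (cmod (u - v) * cmod (f u - cnj (f v)))\<^sup>2"
    by (intro power_mono) auto
  then show ?thesis
    unfolding power_mult_distrib cmod_diff_cnj_square by (simp add: algebra_simps)
qed

lemma Schwarz_Pick_half_plane:
  assumes hol: "f holomorphic_on {z. Im z > 0}" and nonneg: "\<And>z. Im z > 0 \<Longrightarrow> Im (f z) \<ge> 0"
    and u: "Im u > 0" and v: "Im v > 0"
  shows "(cmod (f u - f v))\<^sup>2 * (Im u * Im v) \<le> (cmod (u - v))\<^sup>2 * (Im (f u) * Im (f v))"
proof (rule tendsto_lowerbound)
  let ?g = "\<lambda>\<delta>. (cmod (u - v))\<^sup>2 * ((Im (f u) + \<delta>) * (Im (f v) + \<delta>))"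
  have "(?g \<longlongrightarrow> (cmod (u - v))\<^sup>2 * ((Im (f u) + 0) * (Im (f v) + 0))) (at_right 0)"
    by (intro tendsto_intros)
  then show "(?g \<longlongrightarrow> (cmod (u - v))\<^sup>2 * (Im (f u) * Im (f v))) (at_right 0)" by simp
  have le: "(cmod (f u - f v))\<^sup>2 * (Im u * Im v) \<le> ?g \<delta>" if "\<delta> > 0" for \<delta>
    using Schwarz_Pick_open_half_plane[of "\<lambda>z. f z + \<i> * of_real \<delta>", OF _ _ u v] that nonneg
    by (simp add: add_nonneg_pos holomorphic_intros hol)
  show "\<forall>\<^sub>F \<delta> in at_right 0. (cmod (f u - f v))\<^sup>2 * (Im u * Im v) \<le> ?g \<delta>"
    using eventually_at_right_less[of 0] by (rule eventually_mono) (rule le)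
qed simp

text \<open>
  Applying Schwarz-Pick to \<open>f - i\<eta>\<close> rather than to \<open>f\<close> contracts \<open>|x - p|\<^sup>2 / Im x\<close>
  by the factor \<open>1 - \<eta> / Im p\<close>.
\<close>
lemma half_plane_iterates_tendsto_fixed_point:
  assumes hol: "f holomorphic_on {z. Im z > 0}" and "\<eta> > 0"
    and ge: "\<And>z. Im z > 0 \<Longrightarrow> Im (f z) \<ge> \<eta>"
    and p: "Im p > 0" "f p = p" and u: "Im u > 0"
  shows "(\<lambda>n. (f ^^ n) u) \<longlonglongrightarrow> p"
proof -
  define D where "D x = (cmod (x - p))\<^sup>2 / Im x" for x
  define r where "r = 1 - \<eta> / Im p"
  have pe: "Im p \<ge> \<eta>" using ge[OF p(1)] p(2) by simp
  have r: "0 \<le> r" "r < 1" using pe p \<open>\<eta> > 0\<close> by (auto simp: r_def)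
  have step: "D (f x) \<le> r * D x" if x: "Im x > 0" for x
  proof -
    have fx: "Im (f x) > 0" using ge[OF x] \<open>\<eta> > 0\<close> by simp
    have "(cmod (f x - p))\<^sup>2 * (Im x * Im p) \<le> (cmod (x - p))\<^sup>2 * ((Im (f x) - \<eta>) * (Im p - \<eta>))"
      using Schwarz_Pick_half_plane[of "\<lambda>z. f z - \<i> * of_real \<eta>", OF _ _ x p(1)] ge p(2)
      by (simp add: holomorphic_intros hol)
    also have "\<dots> \<le> (cmod (x - p))\<^sup>2 * (Im (f x) * (Im p - \<eta>))"
      using \<open>\<eta> > 0\<close> pe by (intro mult_left_mono mult_right_mono) auto
    finally have "(cmod (f x - p))\<^sup>2 * (Im x * Im p) \<le> (cmod (x - p))\<^sup>2 * (Im (f x) * (Im p - \<eta>))" .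
    then show ?thesis using x fx p(1) by (simp add: D_def r_def field_simps)
  qed
  have pos: "Im ((f ^^ n) u) > 0" for n
    by (induction n) (use u ge \<open>\<eta> > 0\<close> in \<open>auto intro: less_le_trans\<close>)
  have Dn: "D ((f ^^ n) u) \<le> r ^ n * D u" for n
  proof (induction n)
    case (Suc n)
    have "D ((f ^^ Suc n) u) \<le> r * D ((f ^^ n) u)" using step[OF pos[of n]] by simp
    also have "\<dots> \<le> r * (r ^ n * D u)" using Suc r by (intro mult_left_mono) auto
    finally show ?case by simp
  qed simp
  \<comment> \<open>The quantity \<open>D\<close> measures the distance only relative to
    \<open>Im x\<close>, which is not known to be bounded. With X the distance to \<open>p\<close>
    and e the bound on \<open>D\<close>, X^2 <= e (Im p + X) and 2 e X <= X^2 + e^2 together give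
    X^2 <= 2 e Im p + e^2, where X is gone from the right.\<close>
  let ?b = "\<lambda>n. 2 * (r ^ n * D u) * Im p + (r ^ n * D u)\<^sup>2"
  have "?b \<longlonglongrightarrow> 2 * (0 * D u) * Im p + (0 * D u)\<^sup>2"
    by (intro tendsto_intros LIMSEQ_realpow_zero r)
  moreover have "(cmod ((f ^^ n) u - p))\<^sup>2 \<le> ?b n" for n
  proof -
    let ?x = "(f ^^ n) u" and ?e = "r ^ n * D u"
    have "0 \<le> D ?x" unfolding D_def using pos[of n] by (intro divide_nonneg_pos) auto
    then have e: "?e \<ge> 0" using Dn[of n] by linarith
    have "(cmod (?x - p))\<^sup>2 = D ?x * Im ?x" using pos[of n] by (simp add: D_def)
    also have "\<dots> \<le> ?e * Im ?x" using Dn[of n] pos[of n] by (intro mult_right_mono) auto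
    also have "\<dots> \<le> ?e * (Im p + cmod (?x - p))"
      using abs_Im_le_cmod[of "?x - p"] e by (intro mult_left_mono) auto
    finally have "(cmod (?x - p))\<^sup>2 \<le> ?e * (Im p + cmod (?x - p))" .
    moreover have "0 \<le> (cmod (?x - p) - ?e)\<^sup>2" by simp
    ultimately show ?thesis unfolding power2_diff by (simp add: algebra_simps)
  qed
  ultimately have "(\<lambda>n. (cmod ((f ^^ n) u - p))\<^sup>2) \<longlonglongrightarrow> 0"
    using tendsto_sandwich[of "\<lambda>_. 0" "\<lambda>n. (cmod ((f ^^ n) u - p))\<^sup>2" sequentially ?b 0]
    by simp
  then have "(\<lambda>n. sqrt ((cmod ((f ^^ n) u - p))\<^sup>2)) \<longlonglongrightarrow> sqrt 0" by (rule tendsto_real_sqrt)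
  then have "(\<lambda>n. cmod ((f ^^ n) u - p)) \<longlonglongrightarrow> 0" by simp
  then have "(\<lambda>n. (f ^^ n) u - p) \<longlonglongrightarrow> 0" by (rule tendsto_norm_zero_cancel)
  then show ?thesis by (rule LIM_zero_cancel)
qed

section \<open>Analytic continuation of the inverse branches to subordination functions\<close>

lemma open_upper_half_plane: "open {z. Im z > 0}"
  by (simp add: open_halfspace_Im_gt)

lemma connected_upper_half_plane: "connected {z. Im z > 0}"
  by (simp add: convex_connected convex_halfspace_Im_gt)

lemma open_stolz_angle: "open (stolz_angle \<epsilon>)"
  unfolding stolz_angle_def by (intro open_Collect_conj open_Collect_less continuous_intros)

lemma stolz_angle_nonempty: "\<epsilon> > 0 \<Longrightarrow> stolz_angle \<epsilon> \<noteq> {}"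
  by (auto simp: stolz_angle_def intro!: exI[of _ "Complex 0 (- \<epsilon> / 2)"])

text \<open>
  With \<open>h\<^sub>j(z) = 1 / G\<^bsub>\<mu>\<^sub>j\<^esub>(z) - z\<close>, the value \<open>\<omega>\<^sub>1(z)\<close> must be a fixed point of
  \<open>w \<mapsto> z + h\<^sub>2(z + h\<^sub>1(w))\<close>. The inverse branches provide it for \<open>z\<close> in the open set
  \<open>A = g ` stolz_angle \<epsilon>\<close>, where the iterates converge to it. By Montel's theorem a subsequence
  of the iterates converges on the whole half-plane, which continues \<open>\<omega>\<^sub>1\<close> analytically.
\<close>
lemma subordination:
  assumes "real_distribution \<mu>\<^sub>1" and "real_distribution \<mu>\<^sub>2"
    and "is_free_additive_convolution \<mu>\<^sub>1 \<mu>\<^sub>2 \<nu>"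
  obtains \<omega>\<^sub>1 \<omega>\<^sub>2 where
    "\<omega>\<^sub>1 holomorphic_on {z. Im z > 0}" "\<omega>\<^sub>2 holomorphic_on {z. Im z > 0}"
    "\<And>z. Im z > 0 \<Longrightarrow> Im z \<le> Im (\<omega>\<^sub>1 z)" "\<And>z. Im z > 0 \<Longrightarrow> Im z \<le> Im (\<omega>\<^sub>2 z)"
    "\<And>z. Im z > 0 \<Longrightarrow> cauchy_transform \<mu>\<^sub>1 (\<omega>\<^sub>1 z) = cauchy_transform \<nu> z"
    "\<And>z. Im z > 0 \<Longrightarrow> cauchy_transform \<mu>\<^sub>2 (\<omega>\<^sub>2 z) = cauchy_transform \<nu> z"
    "\<And>z. Im z > 0 \<Longrightarrow> \<omega>\<^sub>1 z + \<omega>\<^sub>2 z = z + 1 / cauchy_transform \<nu> z"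
proof -
  interpret m1: real_distribution \<mu>\<^sub>1 by fact
  interpret m2: real_distribution \<mu>\<^sub>2 by fact
  obtain \<epsilon> g\<^sub>1 g\<^sub>2 g where "\<epsilon> > 0" and nu: "real_distribution \<nu>"
    and g1: "cauchy_inverse_on \<mu>\<^sub>1 \<epsilon> g\<^sub>1" and g2: "cauchy_inverse_on \<mu>\<^sub>2 \<epsilon> g\<^sub>2"
    and g: "cauchy_inverse_on \<nu> \<epsilon> g"
    and gsum: "\<And>w. w \<in> stolz_angle \<epsilon> \<Longrightarrow> g w = g\<^sub>1 w + g\<^sub>2 w - 1 / w"
    using assms(3) unfolding is_free_additive_convolution_def by blast
  interpret n: real_distribution \<nu> by fact
  let ?U = "{z. Im z > 0}" and ?S = "stolz_angle \<epsilon>"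
  let ?G1 = "cauchy_transform \<mu>\<^sub>1" and ?G2 = "cauchy_transform \<mu>\<^sub>2" and ?G = "cauchy_transform \<nu>"
  define h1 where "h1 z = 1 / ?G1 z - z" for z
  define h2 where "h2 z = 1 / ?G2 z - z" for z
  have h: "h1 holomorphic_on ?U" "h2 holomorphic_on ?U"
    unfolding h1_def h2_def
    by (intro holomorphic_intros m1.cauchy_transform_holomorphic m2.cauchy_transform_holomorphic;
        simp add: m1.cauchy_transform_nonzero m2.cauchy_transform_nonzero)+
  have h_nonneg: "Im (h1 z) \<ge> 0" "Im (h2 z) \<ge> 0" if "Im z > 0" for z
    using m1.Im_le_Im_inverse_cauchy_transform[OF that] m2.Im_le_Im_inverse_cauchy_transform[OF that]
    by (auto simp: h1_def h2_def)
  define f where "f z w = z + h2 (z + h1 w)" for z w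
  have Im_f: "Im (f z w) \<ge> Im z" if "Im z > 0" "Im w > 0" for z w
    using h_nonneg(1)[OF that(2)] h_nonneg(2)[of "z + h1 w"] that by (simp add: f_def)
  define \<phi> where "\<phi> n z = (f z ^^ n) \<i>" for n z
  have \<phi>_Suc: "\<phi> (Suc n) z = z + h2 (z + h1 (\<phi> n z))" for n z by (simp add: \<phi>_def f_def)
  have \<phi>_pos: "Im (\<phi> n z) > 0" if "Im z > 0" for n z
    by (induction n) (use that Im_f in \<open>auto simp: \<phi>_def intro: less_le_trans\<close>)
  have \<phi>_ge: "Im (\<phi> (Suc n) z) \<ge> Im z" if "Im z > 0" for n z
    using Im_f[OF that \<phi>_pos[OF that]] by (simp add: \<phi>_def)
  have \<phi>_hol: "\<phi> n holomorphic_on ?U" for n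
  proof (induction n)
    case 0 show ?case by (simp add: \<phi>_def)
  next
    case (Suc n)
    have "(\<lambda>z. z + h1 (\<phi> n z)) holomorphic_on ?U"
      using holomorphic_on_compose_gen[OF Suc h(1)] \<phi>_pos by (intro holomorphic_intros) (auto simp: o_def)
    then have "(\<lambda>z. h2 (z + h1 (\<phi> n z))) holomorphic_on ?U"
      using holomorphic_on_compose_gen[OF _ h(2), of "\<lambda>z. z + h1 (\<phi> n z)" ?U] h_nonneg(1) \<phi>_pos
      by (auto simp: o_def image_subset_iff add_pos_nonneg)
    then show ?case by (simp add: \<phi>_Suc[abs_def] holomorphic_intros)
  qed
  have stolz: "Im (g\<^sub>1 w) > 0" "Im (g\<^sub>2 w) > 0" "Im (g w) > 0" "?G1 (g\<^sub>1 w) = w" "?G2 (g\<^sub>2 w) = w" "?G (g w) = w"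
    if "w \<in> ?S" for w
    using g1 g2 g that by (auto simp: cauchy_inverse_on_def)
  define A where "A = g ` ?S"
  \<comment> \<open>The transform of \<nu> is a left inverse of \<open>g\<close>, so
    \<open>g\<close> is injective and its image \<open>A\<close> is open. This supplies the set from
    which the identity theorem starts.\<close>
  have "inj_on g ?S" by (metis inj_onI stolz(6))
  then have "open A"
    unfolding A_def using g by (intro open_mapping_thm3 open_stolz_angle) (auto simp: cauchy_inverse_on_def)
  have "A \<noteq> {}" using stolz_angle_nonempty[OF \<open>\<epsilon> > 0\<close>] by (simp add: A_def)
  have "A \<subseteq> ?U" using stolz by (auto simp: A_def)
  have lim: "(\<lambda>n. \<phi> n (g w)) \<longlonglongrightarrow> g\<^sub>1 w" if w: "w \<in> ?S" for w
    unfolding \<phi>_def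
  proof (rule half_plane_iterates_tendsto_fixed_point)
    have "(\<lambda>x. g w + h1 x) holomorphic_on ?U" by (intro holomorphic_intros h)
    then show "f (g w) holomorphic_on ?U"
      unfolding f_def using holomorphic_on_compose_gen[OF _ h(2), of "\<lambda>x. g w + h1 x" ?U] h_nonneg(1) stolz(3)[OF w]
      by (intro holomorphic_intros) (auto simp: o_def image_subset_iff add_pos_nonneg)
    show "Im (g w) > 0" "Im (g\<^sub>1 w) > 0" using stolz[OF w] by auto
    show "Im (g w) \<le> Im (f (g w) z)" if "Im z > 0" for z using Im_f stolz[OF w] that by auto
    \<comment> \<open>The defining relation of \<nu> says that the inner map sends
      \<open>g\<^sub>1 w\<close> to \<open>g\<^sub>2 w\<close>, and by symmetry the outer one sends
      \<open>g\<^sub>2 w\<close> back to \<open>g\<^sub>1 w\<close>.\<close>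
    have "g w + h1 (g\<^sub>1 w) = g\<^sub>2 w" using gsum[OF w] by (simp add: h1_def stolz[OF w])
    then show "f (g w) (g\<^sub>1 w) = g\<^sub>1 w"
      using gsum[OF w] stolz(5)[OF w] by (simp only: f_def h2_def) simp
  qed simp
  \<comment> \<open>The iterates themselves need not be bounded; \<open>L\<close> is, and Hurwitz's theorem excludes the limit
    \<open>\<infinity>\<close> of \<open>\<phi>\<close>.\<close>
  define L where "L n z = 1 / (\<phi> n z + \<i>)" for n z
  have nz: "\<phi> n z + \<i> \<noteq> 0" if "Im z > 0" for n z
    using \<phi>_pos[OF that, of n] by (auto simp: complex_eq_iff)
  have L_hol: "L n holomorphic_on ?U" for n
    unfolding L_def by (intro holomorphic_intros \<phi>_hol) (use nz in auto)
  have L_bd: "cmod (L n z) \<le> 1" if "Im z > 0" for n z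
  proof -
    have "1 \<le> cmod (\<phi> n z + \<i>)"
      using \<phi>_pos[OF that, of n] abs_Im_le_cmod[of "\<phi> n z + \<i>"] by simp
    then show ?thesis by (simp add: L_def norm_divide divide_le_eq_1)
  qed
  obtain l r where l: "l holomorphic_on ?U" and "strict_mono (r :: nat \<Rightarrow> nat)"
    and lim_l: "\<And>x. x \<in> ?U \<Longrightarrow> (\<lambda>n. L (r n) x) \<longlonglongrightarrow> l x"
    and unif: "\<And>K. compact K \<Longrightarrow> K \<subseteq> ?U \<Longrightarrow> uniform_limit K (L \<circ> r) l sequentially"
    by (rule Montel[of ?U "{h. h holomorphic_on ?U \<and> (\<forall>z\<in>?U. cmod (h z) \<le> 1)}" L])
       (use open_upper_half_plane L_hol L_bd in \<open>blast+\<close>)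
  have sub: "filterlim r sequentially sequentially"
    using \<open>strict_mono r\<close> by (rule filterlim_subseq)
  have l_A: "l (g w) = 1 / (g\<^sub>1 w + \<i>)" and l_A0: "l (g w) \<noteq> 0" if w: "w \<in> ?S" for w
  proof -
    have "g\<^sub>1 w + \<i> \<noteq> 0" using stolz(1)[OF w] by (auto simp: complex_eq_iff)
    moreover from this have "(\<lambda>n. L (r n) (g w)) \<longlonglongrightarrow> 1 / (g\<^sub>1 w + \<i>)"
      unfolding L_def by (intro tendsto_intros filterlim_compose[OF lim[OF w] sub])
    ultimately show "l (g w) = 1 / (g\<^sub>1 w + \<i>)" "l (g w) \<noteq> 0"
      using LIMSEQ_unique[OF lim_l[of "g w"]] stolz(3)[OF w] by fastforce+
  qed
  have l_nz: "l z \<noteq> 0" if "Im z > 0" for z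
  \<comment> \<open>Hurwitz's theorem concerns nonconstant limits; a constant limit takes its
    nonzero value from \<open>A\<close>.\<close>
  proof (cases "l constant_on ?U")
    case True
    obtain w where "w \<in> ?S" using stolz_angle_nonempty[OF \<open>\<epsilon> > 0\<close>] by auto
    then show ?thesis using True l_A0 stolz(3) that unfolding constant_on_def by fastforce
  next
    case False
    show ?thesis
      by (rule Hurwitz_no_zeros[OF open_upper_half_plane connected_upper_half_plane _ l _ False, of "L \<circ> r"])
         (use L_hol unif nz that in \<open>auto simp: L_def\<close>)
  qed
  define \<omega>\<^sub>1 where "\<omega>\<^sub>1 z = 1 / l z - \<i>" for z
  have w1_hol: "\<omega>\<^sub>1 holomorphic_on ?U"
    unfolding \<omega>\<^sub>1_def by (intro holomorphic_intros l) (use l_nz in auto)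
  have w1_ge: "Im z \<le> Im (\<omega>\<^sub>1 z)" if z: "Im z > 0" for z
  proof -
    have "(\<lambda>n. 1 / L (r n) z - \<i>) \<longlonglongrightarrow> \<omega>\<^sub>1 z"
      unfolding \<omega>\<^sub>1_def by (intro tendsto_intros lim_l) (use l_nz z in auto)
    then have "(\<lambda>n. \<phi> (r n) z) \<longlonglongrightarrow> \<omega>\<^sub>1 z" by (simp add: L_def)
    then have "(\<lambda>n. Im (\<phi> (r n) z)) \<longlonglongrightarrow> Im (\<omega>\<^sub>1 z)" by (rule tendsto_Im)
    \<comment> \<open>The iteration starts at \<i>, whose imaginary part may be below
      \<open>Im z\<close>; the bound holds from the first iterate on, hence the index shift.\<close>
    moreover have "\<exists>N. \<forall>n\<ge>N. Im z \<le> Im (\<phi> (r n) z)"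
    proof (intro exI allI impI)
      fix n :: nat assume "1 \<le> n"
      then have "r n \<ge> 1" using seq_suble[OF \<open>strict_mono r\<close>, of n] by simp
      then show "Im z \<le> Im (\<phi> (r n) z)" using \<phi>_ge[OF z, of "r n - 1"] by simp
    qed
    ultimately show ?thesis by (rule LIMSEQ_le_const)
  qed
  have w1_pos: "Im (\<omega>\<^sub>1 z) > 0" if "Im z > 0" for z using w1_ge[OF that] that by simp
  \<comment> \<open>With this choice the relation for the sum reduces to subordination for
    \<open>\<mu>\<^sub>1\<close>. Subordination for \<open>\<mu>\<^sub>2\<close> is then checked on
    \<open>A\<close> and continued.\<close>
  define \<omega>\<^sub>2 where "\<omega>\<^sub>2 z = z + h1 (\<omega>\<^sub>1 z)" for z
  have w2_ge: "Im z \<le> Im (\<omega>\<^sub>2 z)" if "Im z > 0" for z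
    using h_nonneg(1)[OF w1_pos[OF that]] by (simp add: \<omega>\<^sub>2_def)
  have w2_hol: "\<omega>\<^sub>2 holomorphic_on ?U"
    unfolding \<omega>\<^sub>2_def using holomorphic_on_compose_gen[OF w1_hol h(1)] w1_pos
    by (intro holomorphic_intros) (auto simp: o_def)
  have w1_A: "\<omega>\<^sub>1 (g w) = g\<^sub>1 w" if "w \<in> ?S" for w
    using l_A[OF that] by (simp add: \<omega>\<^sub>1_def)
  have w2_A: "\<omega>\<^sub>2 (g w) = g\<^sub>2 w" if "w \<in> ?S" for w
    unfolding \<omega>\<^sub>2_def w1_A[OF that] h1_def stolz(4)[OF that] using gsum[OF that] by simp
  have G1: "?G1 (\<omega>\<^sub>1 z) = ?G z" if "Im z > 0" for z
  proof (rule analytic_continuation_open[OF \<open>open A\<close> open_upper_half_plane \<open>A \<noteq> {}\<close> connected_upper_half_plane \<open>A \<subseteq> ?U\<close>,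
        where f="\<lambda>z. ?G1 (\<omega>\<^sub>1 z)" and g="?G"])
    show "(\<lambda>z. ?G1 (\<omega>\<^sub>1 z)) holomorphic_on ?U"
      using holomorphic_on_compose_gen[OF w1_hol m1.cauchy_transform_holomorphic] w1_pos by (auto simp: o_def)
    show "?G1 (\<omega>\<^sub>1 z) = ?G z" if "z \<in> A" for z using that stolz w1_A by (auto simp: A_def)
  qed (use that n.cauchy_transform_holomorphic in auto)
  have G2: "?G2 (\<omega>\<^sub>2 z) = ?G z" if "Im z > 0" for z
  proof (rule analytic_continuation_open[OF \<open>open A\<close> open_upper_half_plane \<open>A \<noteq> {}\<close> connected_upper_half_plane \<open>A \<subseteq> ?U\<close>,
        where f="\<lambda>z. ?G2 (\<omega>\<^sub>2 z)" and g="?G"])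
    show "(\<lambda>z. ?G2 (\<omega>\<^sub>2 z)) holomorphic_on ?U"
      using holomorphic_on_compose_gen[OF w2_hol m2.cauchy_transform_holomorphic] w2_ge
      by (auto simp: o_def image_subset_iff intro: less_le_trans)
    show "?G2 (\<omega>\<^sub>2 z) = ?G z" if "z \<in> A" for z using that stolz w2_A by (auto simp: A_def)
  qed (use that n.cauchy_transform_holomorphic in auto)
  have sum: "\<omega>\<^sub>1 z + \<omega>\<^sub>2 z = z + 1 / ?G z" if "Im z > 0" for z
    using G1[OF that] by (simp add: \<omega>\<^sub>2_def h1_def)
  from w1_hol w2_hol w1_ge w2_ge G1 G2 sum show ?thesis by (rule that)
qed

section \<open>Estimates near an atom and in a gap\<close>

context real_distribution
begin

text \<open>
  The sign \<open>\<sigma>\<close> says on which side of the atom the gap lies, so that the estimate serves both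
  ends of the gap.
\<close>
lemma atom_corner_estimate:
  fixes \<alpha> \<sigma> d :: real
  defines "p \<equiv> measure M {\<alpha>}"
  assumes p: "p > 0" and \<sigma>: "\<sigma> \<in> {1, -1}" and d: "d > 0"
    and gap: "AE t in M. \<sigma> * (t - \<alpha>) \<le> 0 \<or> d \<le> \<sigma> * (t - \<alpha>)"
    and z: "Im z > 0" "0 \<le> \<sigma> * (Re z - \<alpha>)" and near: "cmod (z - of_real \<alpha>) \<le> p * d / 4"
  shows "Im (1 / cauchy_transform M z) \<le> (4 / p)\<^sup>2 * Im z"
    and "cmod (1 / cauchy_transform M z) \<le> 4 / p * cmod (z - of_real \<alpha>)"
proof -
  define r where "r = cmod (z - of_real \<alpha>)"
  let ?G = "cauchy_transform M z"
  have abs\<sigma>: "\<bar>\<sigma> * x\<bar> = \<bar>x\<bar>" for x using \<sigma> by auto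
  have "p \<le> 1" unfolding p_def by simp
  then have "p * d \<le> d" using d by simp
  have r: "r > 0" "r \<le> p * d / 4" using z(1) near by (auto simp: r_def complex_eq_iff)
  then have rd: "r \<le> d / 4" using \<open>p * d \<le> d\<close> by simp
  have far: "d / 2 \<le> cmod (z - of_real t)" if "d \<le> \<sigma> * (t - \<alpha>)" for t
  proof -
    have "d \<le> \<bar>t - \<alpha>\<bar>" using that abs\<sigma>[of "t - \<alpha>"] by linarith
    also have "\<dots> = cmod (of_real t - of_real \<alpha>)" by (metis norm_of_real of_real_diff)
    also have "\<dots> \<le> cmod (of_real t - z) + r"
      using norm_triangle_ineq[of "of_real t - z" "z - of_real \<alpha>"] by (simp add: r_def)
    finally show ?thesis using rd d by (simp add: norm_minus_commute)
  qed
  \<comment> \<open>Here the position of \<open>z\<close> matters: it lies on the gap side of the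
    atom, so no point behind the atom is nearer to \<open>z\<close> than the atom itself.\<close>
  have near': "r \<le> cmod (z - of_real t)" if "\<sigma> * (t - \<alpha>) \<le> 0" for t
  proof -
    have "\<bar>Re z - \<alpha>\<bar> \<le> \<bar>Re z - t\<bar>" using that z(2) \<sigma> by auto
    then have "(Re z - \<alpha>)\<^sup>2 \<le> (Re z - t)\<^sup>2" by (simp add: abs_le_square_iff)
    then show ?thesis unfolding r_def cmod_def by simp
  qed
  have "AE t in M. r \<le> cmod (z - of_real t)"
    using gap by eventually_elim (use far near' rd d in force)
  then have E: "cauchy_energy M z \<le> 1 / r\<^sup>2"
    using r(1) by (rule integrable_cauchy_energy(2)[rotated])
  \<comment> \<open>The atom gives the first term, points behind it contribute with the favourable
    sign, and points beyond the gap take off at most \<open>2 / d\<close>. This covers flat approach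
    to the atom; steep approach is covered by the imaginary part in \<open>ImG\<close>.\<close>
  have ReG: "p * (\<sigma> * (Re z - \<alpha>)) / r\<^sup>2 - 2 / d \<le> \<sigma> * Re ?G"
  proof -
    have "(LINT t|M. indicator {\<alpha>} t * (\<sigma> * (Re z - \<alpha>) / r\<^sup>2) - 2 / d)
        \<le> (LINT t|M. \<sigma> * ((Re z - t) / (cmod (z - complex_of_real t))\<^sup>2))"
    proof (rule integral_mono_AE)
      show "integrable M (\<lambda>t. indicator {\<alpha>} t * (\<sigma> * (Re z - \<alpha>) / r\<^sup>2) - 2 / d)"
        by (intro Bochner_Integration.integrable_diff integrable_mult_left integrable_real_indicator)
          (auto simp: emeasure_eq_measure)
      show "integrable M (\<lambda>t. \<sigma> * ((Re z - t) / (cmod (z - complex_of_real t))\<^sup>2))"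
        by (intro integrable_mult_right Re_cauchy_transform z)
      show "AE t in M. indicator {\<alpha>} t * (\<sigma> * (Re z - \<alpha>) / r\<^sup>2) - 2 / d
              \<le> \<sigma> * ((Re z - t) / (cmod (z - complex_of_real t))\<^sup>2)"
        using gap
      proof eventually_elim
        case (elim t)
        show ?case
        proof (cases "t = \<alpha>")
          case True then show ?thesis using d by (simp add: r_def)
        next
          case False
          have "- (2 / d) \<le> \<sigma> * ((Re z - t) / (cmod (z - complex_of_real t))\<^sup>2)"
          proof (cases "\<sigma> * (t - \<alpha>) \<le> 0")
            case True
            then have "0 \<le> \<sigma> * (Re z - t)" using z(2) by (simp add: algebra_simps)
            then have "0 \<le> \<sigma> * ((Re z - t) / (cmod (z - complex_of_real t))\<^sup>2)" by simp
            moreover have "- (2 / d) \<le> 0" using d by simp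
            ultimately show ?thesis by linarith
          next
            case False
            then have D: "d / 2 \<le> cmod (z - of_real t)" using elim far by auto
            let ?c = "cmod (z - of_real t)"
            have c: "?c > 0" using D d by linarith
            have "\<bar>\<sigma> * ((Re z - t) / ?c\<^sup>2)\<bar> = \<bar>Re z - t\<bar> / ?c\<^sup>2"
              unfolding abs\<sigma> by simp
            also have "\<dots> \<le> ?c / ?c\<^sup>2"
              using abs_Re_le_cmod[of "z - of_real t"] by (intro divide_right_mono) auto
            also have "\<dots> = 1 / ?c" using c by (simp add: power2_eq_square)
            also have "\<dots> \<le> 1 / (d / 2)" using D c d by (intro divide_left_mono) auto
            also have "\<dots> = 2 / d" by simp
            finally show ?thesis by linarith
          qed
          then show ?thesis using False by simp
        qed
      qed
    qed
    also have "(LINT t|M. \<sigma> * ((Re z - t) / (cmod (z - complex_of_real t))\<^sup>2)) = \<sigma> * Re ?G"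
      unfolding Re_cauchy_transform(1)[OF z(1)] by (rule integral_mult_right_zero)
    also have "(LINT t|M. indicator {\<alpha>} t * (\<sigma> * (Re z - \<alpha>) / r\<^sup>2) - 2 / d) =
        (LINT t|M. indicator {\<alpha>} t * (\<sigma> * (Re z - \<alpha>) / r\<^sup>2)) - (LINT t|M. 2 / d)"
      by (intro Bochner_Integration.integral_diff integrable_mult_left integrable_real_indicator)
        (auto simp: emeasure_eq_measure)
    also have "\<dots> = p * (\<sigma> * (Re z - \<alpha>)) / r\<^sup>2 - 2 / d"
      by (simp add: p_def prob_UNIV)
    finally show ?thesis .
  qed
  have ImG: "p * Im z / r\<^sup>2 \<le> \<bar>Im ?G\<bar>"
  proof -
    have "Im z * (p / r\<^sup>2) \<le> Im z * cauchy_energy M z"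
      using cauchy_energy_atom[OF z(1), of \<alpha>] z(1) by (intro mult_left_mono) (auto simp: p_def r_def)
    then show ?thesis
      using Im_cauchy_transform[OF z(1)] by (simp add: mult.commute)
  qed
  have "r \<le> \<bar>Re z - \<alpha>\<bar> + \<bar>Im z\<bar>" using cmod_le[of "z - of_real \<alpha>"] by (simp add: r_def)
  then have "r \<le> \<sigma> * (Re z - \<alpha>) + Im z" using z abs\<sigma>[of "Re z - \<alpha>"] by simp
  then have "p * r / r\<^sup>2 \<le> p * (\<sigma> * (Re z - \<alpha>) + Im z) / r\<^sup>2"
    using p by (intro divide_right_mono mult_left_mono) auto
  then have "p / r \<le> p * (\<sigma> * (Re z - \<alpha>)) / r\<^sup>2 + p * Im z / r\<^sup>2"
    using r(1) by (simp add: power2_eq_square distrib_left add_divide_distrib)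
  also have "\<dots> \<le> \<bar>Re ?G\<bar> + 2 / d + \<bar>Im ?G\<bar>"
    using ReG ImG abs\<sigma>[of "Re ?G"] by linarith
  also have "\<dots> \<le> 2 * cmod ?G + 2 / d"
    using abs_Re_le_cmod[of ?G] abs_Im_le_cmod[of ?G] by linarith
  \<comment> \<open>The radius \<open>p * d / 4\<close> is chosen for this step: the loss from
    beyond the gap is absorbed by half of the main term \<open>p / r\<close>.\<close>
  also have "2 / d \<le> p / (2 * r)"
    using r d by (simp add: field_simps)
  finally have low: "p / (4 * r) \<le> cmod ?G" using r(1) by (simp add: field_simps)
  have G0: "cmod ?G > 0" using cauchy_transform_nonzero[OF z(1)] by simp
  have "cmod (1 / ?G) = 1 / cmod ?G" by (simp add: norm_divide)
  also have "\<dots> \<le> 1 / (p / (4 * r))" using low p r(1) G0 by (intro divide_left_mono) auto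
  finally show "cmod (1 / ?G) \<le> 4 / p * cmod (z - of_real \<alpha>)" by (simp add: r_def)
  have "1 / r\<^sup>2 = (4 / p)\<^sup>2 * (p / (4 * r))\<^sup>2" using p r(1) by (simp add: power_divide power_mult_distrib)
  also have "\<dots> \<le> (4 / p)\<^sup>2 * (cmod ?G)\<^sup>2"
    using low p r(1) by (intro mult_left_mono power_mono) auto
  finally have "cauchy_energy M z \<le> (4 / p)\<^sup>2 * (cmod ?G)\<^sup>2" using E by linarith
  then have "Im z * cauchy_energy M z \<le> Im z * ((4 / p)\<^sup>2 * (cmod ?G)\<^sup>2)" using z(1) by simp
  then show "Im (1 / ?G) \<le> (4 / p)\<^sup>2 * Im z"
    unfolding Im_inverse_cauchy_transform[OF z(1)] using G0 by (simp add: pos_divide_le_eq mult_ac)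
qed

text \<open>On the gap the transform is real. The atom at \<alpha> makes it positive just to the
  right of \<alpha>, the atom at \<beta> makes it negative just to the left of \<beta>, and the
  intermediate value theorem applies in between.\<close>

lemma cauchy_transform_zero_in_gap:
  fixes \<alpha> \<beta> :: real
  assumes "\<alpha> < \<beta>" and p: "measure M {\<alpha>} > 0" and q: "measure M {\<beta>} > 0"
    and gap: "AE t in M. t \<le> \<alpha> \<or> \<beta> \<le> t"
  obtains x0 where "\<alpha> < x0" "x0 < \<beta>" "cauchy_transform M (of_real x0) = 0"
proof -
  define R where "R x = (LINT t|M. 1 / (x - t))" for x :: real
  have G: "cauchy_transform M (of_real x) = of_real (R x)" for x
  proof -
    have "cauchy_transform M (of_real x) = (LINT t|M. complex_of_real (1 / (x - t)))"
      unfolding cauchy_transform_def by simp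
    then show ?thesis unfolding integral_complex_of_real R_def .
  qed
  have far: "AE t in M. min (x - \<alpha>) (\<beta> - x) \<le> cmod (of_real x - of_real t)" for x
    using gap
  proof eventually_elim
    case (elim t)
    have "cmod (of_real x - of_real t) = \<bar>x - t\<bar>" by (metis norm_of_real of_real_diff)
    then show ?case using elim by auto
  qed
  have int: "integrable M (\<lambda>t. 1 / (x - t))" if "\<alpha> < x" "x < \<beta>" for x
  proof -
    have "integrable M (\<lambda>t. Re (1 / (complex_of_real x - of_real t)))"
      using that by (intro integrable_Re integrable_cauchy_kernel[OF _ far]) auto
    moreover have "Re (1 / (complex_of_real x - of_real t)) = 1 / (x - t)" for t
      by (metis Re_complex_of_real of_real_1 of_real_diff of_real_divide)
    ultimately show ?thesis by simp
  qed
  have cont: "continuous_on {a..b} R" if "\<alpha> < a" "b < \<beta>" for a b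
  proof (cases "a \<le> b")
    case True
    define e where "e = min (a - \<alpha>) (\<beta> - b)"
    have e: "e > 0" using that by (simp add: e_def)
    have far': "AE t in M. e \<le> cmod (of_real x - of_real t)" if "x \<in> {a..b}" for x
      using far[of x] by eventually_elim (use that in \<open>auto simp: e_def\<close>)
    have "\<bar>R x - R y\<bar> \<le> 1 / (e * e) * \<bar>x - y\<bar>" if "x \<in> {a..b}" "y \<in> {a..b}" for x y
    proof -
      have "cmod (of_real (R x) - of_real (R y)) \<le> cmod (of_real x - of_real y) / (e * e)"
        using cauchy_transform_lipschitz[OF e far'[OF that(1)] e far'[OF that(2)]] by (simp add: G)
      then show ?thesis by (simp flip: of_real_diff)
    qed
    then have "(1 / (e * e))-lipschitz_on {a..b} R"
      by (intro lipschitz_onI) (auto simp: dist_real_def)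
    then show ?thesis by (rule lipschitz_on_continuous_on)
  qed auto
  have low: "measure M {\<alpha>} / (x - \<alpha>) - 1 / (\<beta> - x) \<le> R x" and up: "R x \<le> 1 / (x - \<alpha>) - measure M {\<beta>} / (\<beta> - x)"
    if x: "\<alpha> < x" "x < \<beta>" for x
  proof -
    have ii: "integrable M (\<lambda>t. indicator {c} t * k)" for c k :: real
      by (intro integrable_mult_left integrable_real_indicator) (auto simp: emeasure_eq_measure)
    have "(LINT t|M. indicator {\<alpha>} t * (1 / (x - \<alpha>)) - 1 / (\<beta> - x)) \<le> R x"
      unfolding R_def
    proof (rule integral_mono_AE)
      show "AE t in M. indicator {\<alpha>} t * (1 / (x - \<alpha>)) - 1 / (\<beta> - x) \<le> 1 / (x - t)"
        using gap
      proof eventually_elim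
        case (elim t)
        consider "t = \<alpha>" | "t < \<alpha>" | "\<beta> \<le> t" using elim by linarith
        then show ?case
        proof cases
          case 1 then show ?thesis using x by simp
        next
          case 2
          then have "indicator {\<alpha>} t * (1 / (x - \<alpha>)) = 0" "0 \<le> 1 / (x - t)" "0 \<le> 1 / (\<beta> - x)" using x by auto
          then show ?thesis by linarith
        next
          case 3
          then have "1 / (t - x) \<le> 1 / (\<beta> - x)" using x by (intro divide_left_mono) auto
          moreover have "1 / (x - t) = - (1 / (t - x))" by (metis minus_diff_eq minus_divide_right)
          ultimately show ?thesis using 3 x by simp
        qed
      qed
    qed (intro Bochner_Integration.integrable_diff ii int[OF x] integrable_const)+
    then show "measure M {\<alpha>} / (x - \<alpha>) - 1 / (\<beta> - x) \<le> R x"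
      using ii[of \<alpha> "1 / (x - \<alpha>)"] by (simp add: prob_UNIV)
    have "R x \<le> (LINT t|M. 1 / (x - \<alpha>) - indicator {\<beta>} t * (1 / (\<beta> - x)))"
      unfolding R_def
    proof (rule integral_mono_AE)
      show "AE t in M. 1 / (x - t) \<le> 1 / (x - \<alpha>) - indicator {\<beta>} t * (1 / (\<beta> - x))"
        using gap
      proof eventually_elim
        case (elim t)
        consider "t = \<beta>" | "t > \<beta>" | "t \<le> \<alpha>" using elim by linarith
        then show ?case
        proof cases
          case 1
          have "1 / (x - \<beta>) = - (1 / (\<beta> - x))" by (metis minus_diff_eq minus_divide_right)
          then show ?thesis using 1 x by simp
        next
          case 2
          then have "indicator {\<beta>} t * (1 / (\<beta> - x)) = 0" "1 / (x - t) \<le> 0" "0 \<le> 1 / (x - \<alpha>)"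
            using x by (auto simp: divide_nonpos_neg)
          then show ?thesis by linarith
        next
          case 3
          then have "1 / (x - t) \<le> 1 / (x - \<alpha>)" using x by (intro divide_left_mono) auto
          then show ?thesis using 3 x by simp
        qed
      qed
    qed (intro Bochner_Integration.integrable_diff ii int[OF x] integrable_const)+
    then show "R x \<le> 1 / (x - \<alpha>) - measure M {\<beta>} / (\<beta> - x)"
      using ii[of \<beta> "1 / (\<beta> - x)"] by (simp add: prob_UNIV)
  qed
  define d where "d = \<beta> - \<alpha>"
  \<comment> \<open>At this point the atom at \<alpha> contributes exactly \<open>4 / d\<close>,
    while everything beyond the gap takes off at most \<open>1 / (\<beta> - a)\<close>, which is at
    most \<open>2 / d\<close>. The point \<open>b\<close> plays the same role at the other
    end.\<close>
  define a where "a = \<alpha> + measure M {\<alpha>} * d / 4"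
  define b where "b = \<beta> - measure M {\<beta>} * d / 4"
  have d: "d > 0" using assms by (simp add: d_def)
  have "measure M {\<alpha>} * d \<le> 1 * d" "measure M {\<beta>} * d \<le> 1 * d" using d by (intro mult_right_mono; simp)+
  moreover have "measure M {\<alpha>} * d > 0" "measure M {\<beta>} * d > 0" using d p q by simp_all
  ultimately have ab: "\<alpha> < a" "a < b" "b < \<beta>" "\<beta> - a \<ge> d / 2" "b - \<alpha> \<ge> d / 2"
    unfolding a_def b_def d_def by (auto simp: field_simps)
  have "1 / (\<beta> - a) \<le> 1 / (d / 2)" "1 / (b - \<alpha>) \<le> 1 / (d / 2)"
    using ab d by (intro divide_left_mono; simp)+
  moreover have "measure M {\<alpha>} / (a - \<alpha>) = 4 / d" "measure M {\<beta>} / (\<beta> - b) = 4 / d"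
    using p q by (auto simp: a_def b_def)
  moreover have "2 / d < 4 / d" using d by (simp add: divide_strict_right_mono)
  ultimately have "R b \<le> 0" "0 \<le> R a" using low[of a] up[of b] ab by auto
  then obtain x where "a \<le> x" "x \<le> b" "R x = 0"
    using IVT2'[of R b 0 a] ab cont by auto
  then show thesis using that[of x] ab by (simp add: G)
qed

text \<open>As the transform vanishes at \<open>x0\<close>, it equals \<open>(x0 - z) * K\<close>,
  where the atom at \<alpha> keeps \<open>K\<close> away from 0. The energy is at most
  \<open>1 / \<delta>\<^sup>2\<close>, so energy / |G|^2 grows no faster than |z - x0|^-2.\<close>

lemma gap_estimate:
  fixes \<alpha> \<beta> x0 \<delta> :: real
  assumes p: "measure M {\<alpha>} > 0" and gap: "AE t in M. t \<le> \<alpha> \<or> \<beta> \<le> t"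
    and x0: "\<alpha> < x0" "x0 < \<beta>" "cauchy_transform M (of_real x0) = 0" and \<delta>: "\<delta> > 0"
  obtains B where "B > 0" "\<And>z. \<alpha> + \<delta> \<le> Re z \<Longrightarrow> Re z \<le> \<beta> - \<delta> \<Longrightarrow> 0 < Im z \<Longrightarrow> Im z \<le> 2 \<Longrightarrow>
      Im (1 / cauchy_transform M z) \<le> (B / cmod (z - of_real x0))\<^sup>2 * Im z"
proof -
  define d where "d = \<beta> - \<alpha>"
  \<comment> \<open>The mass of the atom times a lower bound for the integrand of
    \<open>Re K\<close> at \<alpha>: there \<open>Re z - \<alpha>\<close> is at least \<delta>, |z -
    \<alpha>|^2 is at most \<open>d\<^sup>2 + 4\<close> because \<open>Im z\<close> is at most 2,
    and \<open>x0 - \<alpha>\<close> is at most \<open>d\<close>.\<close>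
  define c where "c = measure M {\<alpha>} * (\<delta> / ((d\<^sup>2 + 4) * d))"
  have d: "d > 0" using x0 by (simp add: d_def)
  have c: "c > 0" unfolding c_def using p \<delta> d by (intro mult_pos_pos divide_pos_pos) (auto simp: add_nonneg_pos)
  have est: "Im (1 / cauchy_transform M z) \<le> (1 / (c * \<delta>) / cmod (z - of_real x0))\<^sup>2 * Im z"
    if z: "\<alpha> + \<delta> \<le> Re z" "Re z \<le> \<beta> - \<delta>" "0 < Im z" "Im z \<le> 2" for z
  proof -
    let ?G = "cauchy_transform M z"
    define e where "e = min (x0 - \<alpha>) (\<beta> - x0)"
    have e: "e > 0" using x0 by (simp add: e_def)
    have far0: "AE t in M. e \<le> cmod (of_real x0 - of_real t)"
      using gap
    proof eventually_elim
      case (elim t)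
      have "cmod (of_real x0 - of_real t) = \<bar>x0 - t\<bar>" by (metis norm_of_real of_real_diff)
      then show ?case using elim by (auto simp: e_def)
    qed
    have "AE t in M. \<delta> \<le> cmod (z - of_real t)"
      using gap
    proof eventually_elim
      case (elim t)
      then have "\<delta> \<le> \<bar>Re z - t\<bar>" using z by auto
      then show ?case using abs_Re_le_cmod[of "z - of_real t"] by simp
    qed
    then have E: "cauchy_energy M z \<le> 1 / \<delta>\<^sup>2"
      using \<delta> by (rule integrable_cauchy_energy(2)[rotated])
    \<comment> \<open>The integrand of \<open>K\<close> has nonnegative real part since \<open>Re z\<close> and \<open>x0\<close> lie in the same gap.\<close>
    define K where "K = (LINT t|M. 1 / ((z - complex_of_real t) * (complex_of_real x0 - complex_of_real t)))"
    have intK: "integrable M (\<lambda>t. 1 / ((z - complex_of_real t) * (complex_of_real x0 - complex_of_real t)))"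
      by (rule integrable_cauchy_kernel_mult(1)[OF z(3) AE_Im_le[OF z(3)] e far0])
    have GK: "?G = (of_real x0 - z) * K"
      using cauchy_transform_diff[OF z(3) AE_Im_le[OF z(3)] e far0] x0(3) by (simp add: K_def)
    have Re_int: "Re (1 / ((z - complex_of_real t) * (complex_of_real x0 - complex_of_real t)))
        = (Re z - t) / ((cmod (z - of_real t))\<^sup>2 * (x0 - t))" for t
    proof -
      have "1 / ((z - complex_of_real t) * (complex_of_real x0 - complex_of_real t))
          = (1 / (z - of_real t)) / complex_of_real (x0 - t)" by simp
      moreover have "Re (1 / (z - of_real t)) = (Re z - t) / (cmod (z - of_real t))\<^sup>2"
        unfolding cmod_power2 by (simp add: Re_divide)
      ultimately show ?thesis by (simp only: Re_divide_of_real) simp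
    qed
    have low: "\<delta> / ((d\<^sup>2 + 4) * d) \<le> (Re z - \<alpha>) / ((cmod (z - of_real \<alpha>))\<^sup>2 * (x0 - \<alpha>))"
    proof (rule frac_le)
      have "(Re z - \<alpha>)\<^sup>2 \<le> d\<^sup>2" "(Im z)\<^sup>2 \<le> 2\<^sup>2" using z \<delta> by (intro power_mono; simp add: d_def)+
      then have "(cmod (z - of_real \<alpha>))\<^sup>2 \<le> d\<^sup>2 + 4" by (simp add: cmod_power2)
      then show "(cmod (z - of_real \<alpha>))\<^sup>2 * (x0 - \<alpha>) \<le> (d\<^sup>2 + 4) * d"
        using x0 by (intro mult_mono) (auto simp: d_def)
      have "z \<noteq> of_real \<alpha>" using z(3) by (auto simp: complex_eq_iff)
      then show "0 < (cmod (z - of_real \<alpha>))\<^sup>2 * (x0 - \<alpha>)" using x0 by simp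
    qed (use z \<delta> in auto)
    have "c \<le> (LINT t|M. indicator {\<alpha>} t * (\<delta> / ((d\<^sup>2 + 4) * d)))" by (simp add: c_def)
    also have "\<dots> \<le> (LINT t|M. Re (1 / ((z - complex_of_real t) * (complex_of_real x0 - complex_of_real t))))"
    proof (rule integral_mono_AE)
      show "AE t in M. indicator {\<alpha>} t * (\<delta> / ((d\<^sup>2 + 4) * d))
          \<le> Re (1 / ((z - complex_of_real t) * (complex_of_real x0 - complex_of_real t)))"
        using gap
      proof eventually_elim
        case (elim t)
        have "0 \<le> (Re z - t) / ((cmod (z - of_real t))\<^sup>2 * (x0 - t))"
        proof (cases "t \<le> \<alpha>")
          case True then show ?thesis using z \<delta> x0 by (intro divide_nonneg_nonneg mult_nonneg_nonneg) auto
        next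
          case False
          then have "Re z - t \<le> 0" "(cmod (z - of_real t))\<^sup>2 * (x0 - t) \<le> 0"
            using elim z \<delta> x0 by (auto simp: mult_nonneg_nonpos)
          then show ?thesis by (simp add: divide_nonpos_nonpos)
        qed
        then show ?case unfolding Re_int using low by (cases "t = \<alpha>") auto
      qed
      show "integrable M (\<lambda>t. indicator {\<alpha>} t * (\<delta> / ((d\<^sup>2 + 4) * d)))"
        by (intro integrable_mult_left integrable_real_indicator) (auto simp: emeasure_eq_measure)
    qed (use intK in auto)
    also have "\<dots> = Re K" unfolding K_def using intK by (rule integral_Re)
    finally have "c \<le> cmod K" using complex_Re_le_cmod[of K] by linarith
    then have "c * cmod (z - of_real x0) \<le> cmod K * cmod (z - of_real x0)" by (rule mult_right_mono) simp
    then have "c * cmod (z - of_real x0) \<le> cmod ?G"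
      unfolding GK norm_mult by (simp add: norm_minus_commute mult.commute)
    then have cz: "(c * cmod (z - of_real x0))\<^sup>2 \<le> (cmod ?G)\<^sup>2" using c by (intro power_mono) auto
    have z0: "cmod (z - of_real x0) > 0" using z(3) by (auto simp: complex_eq_iff)
    have G0: "cmod ?G > 0" using cauchy_transform_nonzero[OF z(3)] by simp
    have "cauchy_energy M z / (cmod ?G)\<^sup>2 \<le> (1 / \<delta>\<^sup>2) / (c * cmod (z - of_real x0))\<^sup>2"
      using E cz c z0 G0 by (intro frac_le) auto
    also have "\<dots> = (1 / (c * \<delta>) / cmod (z - of_real x0))\<^sup>2"
      by (simp add: power_mult_distrib power_divide)
    finally have "Im z * (cauchy_energy M z / (cmod ?G)\<^sup>2) \<le> Im z * (1 / (c * \<delta>) / cmod (z - of_real x0))\<^sup>2"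
      using z(3) by (intro mult_left_mono) auto
    then show ?thesis unfolding Im_inverse_cauchy_transform[OF z(3)] by (simp add: mult.commute)
  qed
  show thesis by (rule that[of "1 / (c * \<delta>)"]) (use c \<delta> est in auto)
qed

end

text \<open>One fixed vertical sequence suffices, since the Lipschitz bounds make it Cauchy. The
  same formula is meaningful inside the half-plane, where it returns \<open>f z\<close> for
  holomorphic \<open>f\<close>, so a single function lives on the closed half-plane. Where the
  sequence diverges, \<open>lim\<close> is unspecified.\<close>

definition boundary_value :: "(complex \<Rightarrow> complex) \<Rightarrow> complex \<Rightarrow> complex" where
  "boundary_value f z = lim (\<lambda>n. f (z + \<i> * of_real (1 / real (Suc n))))"

lemma shift_up_tendsto: "(\<lambda>n. z + \<i> * of_real (1 / real (Suc n))) \<longlonglongrightarrow> z"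
proof -
  have "(\<lambda>n. z + \<i> * of_real (1 / real (Suc n))) \<longlonglongrightarrow> z + \<i> * of_real 0"
    by (intro tendsto_intros LIMSEQ_Suc[OF lim_1_over_n])
  then show ?thesis by simp
qed

text \<open>The factors \<open>Im u\<close> and \<open>Im v\<close> cancel from Schwarz-Pick, so the
  Lipschitz constant does not degenerate at the real axis. Separate constants at the two points
  leave room for a weight that varies with the point.\<close>

lemma Schwarz_Pick_lipschitz:
  assumes hol: "f holomorphic_on {z. Im z > 0}" and nonneg: "\<And>z. Im z > 0 \<Longrightarrow> Im (f z) \<ge> 0"
    and u: "Im u > 0" "Im (f u) \<le> A\<^sup>2 * Im u" "A \<ge> 0"
    and v: "Im v > 0" "Im (f v) \<le> B\<^sup>2 * Im v" "B \<ge> 0"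
  shows "cmod (f u - f v) \<le> A * B * cmod (u - v)"
proof (rule power2_le_imp_le)
  have "(cmod (f u - f v))\<^sup>2 * (Im u * Im v) \<le> (cmod (u - v))\<^sup>2 * (Im (f u) * Im (f v))"
    by (rule Schwarz_Pick_half_plane[OF hol nonneg u(1) v(1)])
  also have "\<dots> \<le> (cmod (u - v))\<^sup>2 * ((A\<^sup>2 * Im u) * (B\<^sup>2 * Im v))"
    using u v nonneg by (intro mult_left_mono mult_mono) auto
  also have "\<dots> = (A * B * cmod (u - v))\<^sup>2 * (Im u * Im v)"
    by (simp add: power_mult_distrib mult_ac)
  finally show "(cmod (f u - f v))\<^sup>2 \<le> (A * B * cmod (u - v))\<^sup>2"
    using u(1) v(1) by (simp add: mult_le_cancel_right)
qed (use u v in simp)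

text \<open>
  If \<open>Im f(z) / Im z\<close> is locally bounded near the real axis, Schwarz-Pick makes \<open>f\<close> locally
  Lipschitz there, so that \<open>f\<close> extends continuously to the axis with real values.
  The weight \<open>k(z) = C / |z - x\<^sub>0|\<close> allows for a pole at \<open>x\<^sub>0\<close>.
\<close>
locale boundary_lipschitz =
  fixes f :: "complex \<Rightarrow> complex" and k :: "complex \<Rightarrow> real" and T :: "complex set"
  assumes hol: "f holomorphic_on {z. Im z > 0}" and nonneg: "\<And>z. Im z > 0 \<Longrightarrow> Im (f z) \<ge> 0"
    and k_nonneg: "\<And>z. k z \<ge> 0"
    and bound: "\<And>z. z \<in> T \<Longrightarrow> Im z > 0 \<Longrightarrow> Im (f z) \<le> (k z)\<^sup>2 * Im z"
begin

text \<open>What passing to the vertical limit requires: the shifted points eventually satisfy the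
  bound, and the weight converges to its value. For the weight \<open>B / cmod (z - x0)\<close> this
  excludes \<open>x0\<close>, where division by zero gives 0 while the shifted weights
  diverge.\<close>

definition regular :: "complex set" where
  "regular = {z. Im z \<ge> 0 \<and> (\<forall>\<^sub>F n in sequentially. z + \<i> * of_real (1 / real (Suc n)) \<in> T) \<and>
     (\<lambda>n. k (z + \<i> * of_real (1 / real (Suc n)))) \<longlonglongrightarrow> k z}"

lemma boundary_value_tendsto:
  assumes "z \<in> regular"
  shows "(\<lambda>n. f (z + \<i> * of_real (1 / real (Suc n)))) \<longlonglongrightarrow> boundary_value f z"
proof -
  let ?z = "\<lambda>n. z + \<i> * of_real (1 / real (Suc n))"
  have z: "Im z \<ge> 0" and T: "\<forall>\<^sub>F n in sequentially. ?z n \<in> T" and k: "(\<lambda>n. k (?z n)) \<longlonglongrightarrow> k z"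
    using assms by (auto simp: regular_def)
  have pos: "Im (?z n) > 0" for n using z by (simp add: add_nonneg_pos)
  define C where "C = k z + 1"
  have C: "C > 0" using k_nonneg[of z] by (simp add: C_def)
  have "\<forall>\<^sub>F n in sequentially. k (?z n) < C" using k by (rule order_tendstoD) (simp add: C_def)
  with T have "\<forall>\<^sub>F n in sequentially. ?z n \<in> T \<and> k (?z n) < C" by (rule eventually_conj)
  then obtain N where N: "\<And>n. n \<ge> N \<Longrightarrow> ?z n \<in> T \<and> k (?z n) < C" by (auto simp: eventually_sequentially)
  have "Cauchy (\<lambda>n. f (?z n))"
  proof (rule metric_CauchyI)
    fix e :: real assume "e > 0"
    then have "e / (C * C) > 0" using C by simp
    moreover have "Cauchy ?z" using shift_up_tendsto by (rule LIMSEQ_imp_Cauchy)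
    ultimately obtain N' where N': "\<And>m n. m \<ge> N' \<Longrightarrow> n \<ge> N' \<Longrightarrow> dist (?z m) (?z n) < e / (C * C)"
      by (meson metric_CauchyD)
    show "\<exists>M. \<forall>m\<ge>M. \<forall>n\<ge>M. dist (f (?z m)) (f (?z n)) < e"
    proof (intro exI allI impI)
      fix m n assume mn: "max N N' \<le> m" "max N N' \<le> n"
      have "cmod (f (?z m) - f (?z n)) \<le> k (?z m) * k (?z n) * cmod (?z m - ?z n)"
        using N mn by (intro Schwarz_Pick_lipschitz hol nonneg pos bound k_nonneg) auto
      also have "\<dots> \<le> C * C * cmod (?z m - ?z n)"
        using N[of m] N[of n] mn C k_nonneg by (intro mult_right_mono mult_mono) (auto simp: less_imp_le)
      also have "\<dots> < e" using N'[of m n] mn C by (simp add: dist_norm pos_less_divide_eq mult.commute)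
      finally show "dist (f (?z m)) (f (?z n)) < e" by (simp add: dist_norm)
    qed
  qed
  then show ?thesis unfolding boundary_value_def
    using convergent_LIMSEQ_iff Cauchy_convergent_iff by blast
qed

lemma boundary_value_lipschitz:
  assumes z: "z \<in> regular" and w: "w \<in> regular"
  shows "cmod (boundary_value f z - boundary_value f w) \<le> k z * k w * cmod (z - w)"
proof (rule LIMSEQ_le)
  let ?s = "\<lambda>z n. z + \<i> * of_real (1 / real (Suc n))"
  show "(\<lambda>n. cmod (f (?s z n) - f (?s w n))) \<longlonglongrightarrow> cmod (boundary_value f z - boundary_value f w)"
    by (intro tendsto_intros boundary_value_tendsto z w)
  show "(\<lambda>n. k (?s z n) * k (?s w n) * cmod (?s z n - ?s w n)) \<longlonglongrightarrow> k z * k w * cmod (z - w)"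
    using z w by (intro tendsto_intros shift_up_tendsto) (auto simp: regular_def)
  have "\<forall>\<^sub>F n in sequentially. ?s z n \<in> T" "\<forall>\<^sub>F n in sequentially. ?s w n \<in> T"
    using z w by (auto simp: regular_def)
  then have "\<forall>\<^sub>F n in sequentially. cmod (f (?s z n) - f (?s w n)) \<le> k (?s z n) * k (?s w n) * cmod (?s z n - ?s w n)"
  proof eventually_elim
    case (elim n)
    then show ?case using z w
      by (intro Schwarz_Pick_lipschitz hol nonneg bound k_nonneg) (auto simp: regular_def add_nonneg_pos)
  qed
  then show "\<exists>N. \<forall>n\<ge>N. cmod (f (?s z n) - f (?s w n)) \<le> k (?s z n) * k (?s w n) * cmod (?s z n - ?s w n)"
    by (simp add: eventually_sequentially)
qed

lemma boundary_value_real: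
  assumes z: "z \<in> regular" and "Im z = 0"
  shows "Im (boundary_value f z) = 0"
proof -
  let ?z = "\<lambda>n. z + \<i> * of_real (1 / real (Suc n))"
  have lim: "(\<lambda>n. Im (f (?z n))) \<longlonglongrightarrow> Im (boundary_value f z)"
    by (intro tendsto_Im boundary_value_tendsto z)
  have pos: "Im (?z n) > 0" for n using assms by simp
  have "Im (boundary_value f z) \<ge> 0"
    by (rule LIMSEQ_le_const[OF lim]) (use nonneg pos in auto)
  moreover have "Im (boundary_value f z) \<le> 0"
  proof (rule LIMSEQ_le[OF lim])
    have "(\<lambda>n. (k (?z n))\<^sup>2 * Im (?z n)) \<longlonglongrightarrow> (k z)\<^sup>2 * Im z"
      using z by (intro tendsto_intros shift_up_tendsto) (auto simp: regular_def)
    then show "(\<lambda>n. (k (?z n))\<^sup>2 * Im (?z n)) \<longlonglongrightarrow> 0" using assms(2) by simp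
    have "\<forall>\<^sub>F n in sequentially. ?z n \<in> T" using z by (auto simp: regular_def)
    then show "\<exists>N. \<forall>n\<ge>N. Im (f (?z n)) \<le> (k (?z n))\<^sup>2 * Im (?z n)"
      using bound pos by (force simp: eventually_sequentially)
  qed
  ultimately show ?thesis by simp
qed

end

lemma boundary_value_interior:
  assumes "f holomorphic_on {z. Im z > 0}" "Im z > 0"
  shows "boundary_value f z = f z"
proof -
  have "isCont f z"
    using holomorphic_on_imp_continuous_on[OF assms(1)] open_upper_half_plane assms(2)
    by (simp add: continuous_on_eq_continuous_at)
  then have "(\<lambda>n. f (z + \<i> * of_real (1 / real (Suc n)))) \<longlonglongrightarrow> f z"
    using shift_up_tendsto by (rule isCont_tendsto_compose)
  then show ?thesis unfolding boundary_value_def by (rule limI)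
qed

section \<open>Boundary values on a gap between two atoms\<close>

text \<open>One subordination function in isolation, so that the same argument serves both. The
  other one survives only in \<open>Im_le\<close>, which follows from the relation for the sum and
  its own lower bound.\<close>

locale gap_subordination = N: real_distribution \<nu> + M: real_distribution \<mu>
  for \<nu> \<mu> :: "real measure" +
  fixes \<omega> :: "complex \<Rightarrow> complex" and \<alpha> \<beta> :: real
  assumes less: "\<alpha> < \<beta>" and atom_\<alpha>: "measure \<nu> {\<alpha>} > 0" and atom_\<beta>: "measure \<nu> {\<beta>} > 0"
    and gap: "AE t in \<nu>. t \<le> \<alpha> \<or> \<beta> \<le> t"
    and hol: "\<omega> holomorphic_on {z. Im z > 0}"
    and Im_ge: "\<And>z. Im z > 0 \<Longrightarrow> Im z \<le> Im (\<omega> z)"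
    and Im_le: "\<And>z. Im z > 0 \<Longrightarrow> Im (\<omega> z) \<le> Im (1 / cauchy_transform \<nu> z)"
    and subord: "\<And>z. Im z > 0 \<Longrightarrow> cauchy_transform \<mu> (\<omega> z) = cauchy_transform \<nu> z"
begin

abbreviation f :: "complex \<Rightarrow> complex" where "f \<equiv> boundary_value \<omega>"

abbreviation above :: "complex \<Rightarrow> nat \<Rightarrow> complex" where
  "above z n \<equiv> z + \<i> * of_real (1 / real (Suc n))"

lemma nonneg: "Im z > 0 \<Longrightarrow> Im (\<omega> z) \<ge> 0"
  using Im_ge[of z] by simp

lemma gap_corner:
  assumes "(\<sigma>, \<gamma>) \<in> {(1, \<alpha>), (-1, \<beta>)}"
  shows "AE t in \<nu>. \<sigma> * (t - \<gamma>) \<le> 0 \<or> \<beta> - \<alpha> \<le> \<sigma> * (t - \<gamma>)"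
    and "\<sigma> \<in> {1, -1}" and "measure \<nu> {\<gamma>} > 0"
  using gap assms atom_\<alpha> atom_\<beta> by auto

text \<open>Near the atom the weight is the constant \<open>4 / p\<close>. The Lipschitz bound and
  \<open>Im_ge\<close> show that the images of the vertical sequence approach
  \<open>f \<gamma>\<close> within a cone, so the atom limit applies to \<mu> along them, and
  subordination rewrites it in terms of \<nu>.\<close>

lemma corner:
  assumes \<sigma>: "(\<sigma>, \<gamma>) \<in> {(1, \<alpha>), (-1, \<beta>)}"
  defines "p \<equiv> measure \<nu> {\<gamma>}"
  shows corner_real: "Im (f (of_real \<gamma>)) = 0"
    and corner_lipschitz: "\<And>z. \<lbrakk>0 \<le> \<sigma> * (Re z - \<gamma>); 0 \<le> Im z; cmod (z - of_real \<gamma>) < p * (\<beta> - \<alpha>) / 4\<rbrakk>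
      \<Longrightarrow> cmod (f z - f (of_real \<gamma>)) \<le> (4 / p)\<^sup>2 * cmod (z - of_real \<gamma>)"
    and corner_tendsto: "(\<lambda>n. \<omega> (above (of_real \<gamma>) n)) \<longlonglongrightarrow> f (of_real \<gamma>)"
    and corner_atom: "(\<lambda>n. (\<omega> (above (of_real \<gamma>) n) - f (of_real \<gamma>)) * cauchy_transform \<nu> (above (of_real \<gamma>) n))
      \<longlonglongrightarrow> of_real (measure \<mu> {Re (f (of_real \<gamma>))})"
    and corner_inverse: "(\<lambda>n. 1 / cauchy_transform \<nu> (above (of_real \<gamma>) n)) \<longlonglongrightarrow> 0"
    and corner_mass: "(\<lambda>n. (above (of_real \<gamma>) n - of_real \<gamma>) * cauchy_transform \<nu> (above (of_real \<gamma>) n))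
      \<longlonglongrightarrow> of_real p"
proof -
  have p: "p > 0" using gap_corner(3)[OF \<sigma>] by (simp add: p_def)
  have d: "\<beta> - \<alpha> > 0" using less by simp
  define T where "T = {z. 0 \<le> \<sigma> * (Re z - \<gamma>) \<and> cmod (z - of_real \<gamma>) \<le> p * (\<beta> - \<alpha>) / 4}"
  note est = N.atom_corner_estimate[OF gap_corner(3)[OF \<sigma>] gap_corner(2)[OF \<sigma>] d gap_corner(1)[OF \<sigma>], folded p_def]
  interpret boundary_lipschitz \<omega> "\<lambda>_. 4 / p" T
  proof
    fix z assume z: "z \<in> T" "Im z > 0"
    then have "Im (1 / cauchy_transform \<nu> z) \<le> (4 / p)\<^sup>2 * Im z"
      by (intro est(1)) (auto simp: T_def)
    then show "Im (\<omega> z) \<le> (4 / p)\<^sup>2 * Im z" using Im_le[OF z(2)] by linarith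
  qed (use hol nonneg p in auto)
  have inT: "\<forall>\<^sub>F n in sequentially. above z n \<in> T"
    if z: "0 \<le> \<sigma> * (Re z - \<gamma>)" "cmod (z - of_real \<gamma>) < p * (\<beta> - \<alpha>) / 4" for z
  proof -
    have "(\<lambda>n. cmod (above z n - of_real \<gamma>)) \<longlonglongrightarrow> cmod (z - of_real \<gamma>)"
      by (intro tendsto_intros shift_up_tendsto)
    then have "\<forall>\<^sub>F n in sequentially. cmod (above z n - of_real \<gamma>) < p * (\<beta> - \<alpha>) / 4"
      using z(2) by (rule order_tendstoD)
    then show ?thesis by eventually_elim (use z(1) in \<open>simp add: T_def\<close>)
  qed
  have reg: "z \<in> regular" if "0 \<le> \<sigma> * (Re z - \<gamma>)" "0 \<le> Im z" "cmod (z - of_real \<gamma>) < p * (\<beta> - \<alpha>) / 4" for z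
    unfolding regular_def using that inT[of z] by simp
  have pd: "p * (\<beta> - \<alpha>) / 4 > 0" using p d by simp
  have reg\<gamma>: "of_real \<gamma> \<in> regular" using pd by (intro reg) auto
  show re: "Im (f (of_real \<gamma>)) = 0" by (rule boundary_value_real[OF reg\<gamma>]) simp
  show lip: "cmod (f z - f (of_real \<gamma>)) \<le> (4 / p)\<^sup>2 * cmod (z - of_real \<gamma>)"
    if "0 \<le> \<sigma> * (Re z - \<gamma>)" "0 \<le> Im z" "cmod (z - of_real \<gamma>) < p * (\<beta> - \<alpha>) / 4" for z
    using boundary_value_lipschitz[OF reg[OF that] reg\<gamma>] by (simp add: power2_eq_square)
  show tends: "(\<lambda>n. \<omega> (above (of_real \<gamma>) n)) \<longlonglongrightarrow> f (of_real \<gamma>)"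
    by (rule boundary_value_tendsto[OF reg\<gamma>])
  let ?z = "above (of_real \<gamma>)"
  have "\<forall>\<^sub>F n in sequentially. ?z n \<in> T" using pd by (intro inT) auto
  moreover have "\<forall>\<^sub>F n in sequentially. 1 / real (Suc n) < p * (\<beta> - \<alpha>) / 4"
    using LIMSEQ_Suc[OF lim_1_over_n] pd by (rule order_tendstoD)
  ultimately have "\<forall>\<^sub>F n in sequentially. ?z n \<in> T \<and> 1 / real (Suc n) < p * (\<beta> - \<alpha>) / 4"
    by (rule eventually_conj)
  then obtain m where m: "\<And>n. n \<ge> m \<Longrightarrow> ?z n \<in> T \<and> 1 / real (Suc n) < p * (\<beta> - \<alpha>) / 4"
    by (auto simp: eventually_sequentially)
  have dist: "cmod (?z n - of_real \<gamma>) = 1 / real (Suc n)" for n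
  proof -
    have "?z n - of_real \<gamma> = \<i> * of_real (1 / real (Suc n))" by simp
    then show ?thesis by (simp only: norm_mult norm_ii norm_of_real) simp
  qed
  have Imz: "Im (?z n) = 1 / real (Suc n)" "Im (?z n) > 0" for n by auto
  let ?a = "Re (f (of_real \<gamma>))"
  have a: "f (of_real \<gamma>) = of_real ?a" using re by (simp add: complex_eq_iff)
  \<comment> \<open>The first \<open>m\<close> terms may leave the region where the estimate holds,
    so the limit is taken along the shifted sequence.\<close>
  have "(\<lambda>n. (\<omega> (?z (n + m)) - of_real ?a) * cauchy_transform \<mu> (\<omega> (?z (n + m)))) \<longlonglongrightarrow> of_real (measure \<mu> {?a})"
  proof (rule M.cauchy_transform_atom_limit)
    show "(\<lambda>n. \<omega> (?z (n + m))) \<longlonglongrightarrow> of_real ?a"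
      using LIMSEQ_ignore_initial_segment[OF tends, of m] a by simp
    show "Im (\<omega> (?z (n + m))) > 0" for n using Im_ge[OF Imz(2)] Imz(2) by (rule less_le_trans[rotated])
    show "cmod (\<omega> (?z (n + m)) - of_real ?a) \<le> (4 / p)\<^sup>2 * Im (\<omega> (?z (n + m)))" for n
    proof -
      have "cmod (f (?z (n + m)) - f (of_real \<gamma>)) \<le> (4 / p)\<^sup>2 * cmod (?z (n + m) - of_real \<gamma>)"
        using m[of "n + m"] dist[of "n + m"] Imz(2)[of "n + m"] by (intro lip) (auto simp: T_def)
      also have "cmod (?z (n + m) - of_real \<gamma>) = Im (?z (n + m))" unfolding dist Imz(1) ..
      also have "(4 / p)\<^sup>2 * Im (?z (n + m)) \<le> (4 / p)\<^sup>2 * Im (\<omega> (?z (n + m)))"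
        by (intro mult_left_mono Im_ge Imz) auto
      finally show ?thesis using boundary_value_interior[OF hol Imz(2)] a by metis
    qed
  qed
  then have "(\<lambda>n. (\<omega> (?z (n + m)) - f (of_real \<gamma>)) * cauchy_transform \<nu> (?z (n + m))) \<longlonglongrightarrow> of_real (measure \<mu> {?a})"
    unfolding a[symmetric] subord[OF Imz(2)] .
  then show "(\<lambda>n. (\<omega> (?z n) - f (of_real \<gamma>)) * cauchy_transform \<nu> (?z n)) \<longlonglongrightarrow> of_real (measure \<mu> {?a})"
    by (rule LIMSEQ_offset)
  show "(\<lambda>n. 1 / cauchy_transform \<nu> (?z n)) \<longlonglongrightarrow> 0"
  proof (rule Lim_null_comparison)
    show "\<forall>\<^sub>F n in sequentially. norm (1 / cauchy_transform \<nu> (?z n)) \<le> 4 / p * (1 / real (Suc n))"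
      unfolding eventually_sequentially
    proof (intro exI allI impI)
      fix n assume "m \<le> n"
      then show "norm (1 / cauchy_transform \<nu> (?z n)) \<le> 4 / p * (1 / real (Suc n))"
        using est(2)[OF Imz(2)[of n]] m[of n] unfolding dist by (simp add: T_def)
    qed
    have "(\<lambda>n. 4 / p * (1 / real (Suc n))) \<longlonglongrightarrow> 4 / p * 0"
      by (intro tendsto_intros LIMSEQ_Suc[OF lim_1_over_n])
    then show "(\<lambda>n. 4 / p * (1 / real (Suc n))) \<longlonglongrightarrow> 0" by simp
  qed
  show "(\<lambda>n. (?z n - of_real \<gamma>) * cauchy_transform \<nu> (?z n)) \<longlonglongrightarrow> of_real p"
    unfolding p_def
  proof (rule N.cauchy_transform_atom_limit[where K=1])
    show "cmod (?z n - of_real \<gamma>) \<le> 1 * Im (?z n)" for n unfolding dist Imz by simp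
  qed (use shift_up_tendsto in auto)
qed

lemma gap_lipschitz:
  assumes x0: "\<alpha> < x0" "x0 < \<beta>" "cauchy_transform \<nu> (of_real x0) = 0" and "\<delta> > 0"
  obtains C where "C > 0"
    "\<And>z w. \<lbrakk>Re z \<in> {\<alpha> + \<delta>..\<beta> - \<delta>}; Im z \<in> {0..1}; z \<noteq> of_real x0;
        Re w \<in> {\<alpha> + \<delta>..\<beta> - \<delta>}; Im w \<in> {0..1}; w \<noteq> of_real x0\<rbrakk>
      \<Longrightarrow> cmod (f z - f w) \<le> C * cmod (z - w) / (cmod (z - of_real x0) * cmod (w - of_real x0))"
    "\<And>z. \<lbrakk>Re z \<in> {\<alpha> + \<delta>..\<beta> - \<delta>}; Im z = 0; z \<noteq> of_real x0\<rbrakk>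
      \<Longrightarrow> Im (f z) = 0 \<and> (\<lambda>n. \<omega> (above z n)) \<longlonglongrightarrow> f z"
proof -
  obtain B where B: "B > 0" "\<And>z. \<alpha> + \<delta> \<le> Re z \<Longrightarrow> Re z \<le> \<beta> - \<delta> \<Longrightarrow> 0 < Im z \<Longrightarrow> Im z \<le> 2 \<Longrightarrow>
      Im (1 / cauchy_transform \<nu> z) \<le> (B / cmod (z - of_real x0))\<^sup>2 * Im z"
    using N.gap_estimate[OF atom_\<alpha> gap x0 \<open>\<delta> > 0\<close>] by metis
  \<comment> \<open>Height 2 leaves room for upward shifts, of length at most 1, of points of height
    at most 1.\<close>
  interpret boundary_lipschitz \<omega> "\<lambda>z. B / cmod (z - of_real x0)" "{z. Re z \<in> {\<alpha> + \<delta>..\<beta> - \<delta>} \<and> Im z \<le> 2}"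
  proof
    fix z assume z: "z \<in> {z. Re z \<in> {\<alpha> + \<delta>..\<beta> - \<delta>} \<and> Im z \<le> 2}" "Im z > 0"
    then have "Im (1 / cauchy_transform \<nu> z) \<le> (B / cmod (z - of_real x0))\<^sup>2 * Im z"
      by (intro B(2)) auto
    then show "Im (\<omega> z) \<le> (B / cmod (z - of_real x0))\<^sup>2 * Im z" using Im_le[OF z(2)] by linarith
  qed (use hol nonneg B(1) in auto)
  have reg: "z \<in> regular" if z: "Re z \<in> {\<alpha> + \<delta>..\<beta> - \<delta>}" "Im z \<in> {0..1}" "z \<noteq> of_real x0" for z
  proof -
    have "(\<lambda>n. B / cmod (above z n - of_real x0)) \<longlonglongrightarrow> B / cmod (z - of_real x0)"
      using z(3) by (intro tendsto_intros shift_up_tendsto) auto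
    moreover have "1 / real (Suc n) \<le> 1" for n by simp
    then have "Im z + 1 / real (Suc n) \<le> 2" for n using z(2) by (metis add_mono atLeastAtMost_iff one_add_one)
    ultimately show ?thesis using z unfolding regular_def by auto
  qed
  show thesis
  proof (rule that[of "B * B"])
    show "cmod (f z - f w) \<le> B * B * cmod (z - w) / (cmod (z - of_real x0) * cmod (w - of_real x0))"
      if "Re z \<in> {\<alpha> + \<delta>..\<beta> - \<delta>}" "Im z \<in> {0..1}" "z \<noteq> of_real x0"
        "Re w \<in> {\<alpha> + \<delta>..\<beta> - \<delta>}" "Im w \<in> {0..1}" "w \<noteq> of_real x0" for z w
      using boundary_value_lipschitz[OF reg[OF that(1-3)] reg[OF that(4-6)]] by simp
    show "Im (f z) = 0 \<and> (\<lambda>n. \<omega> (above z n)) \<longlonglongrightarrow> f z"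
      if "Re z \<in> {\<alpha> + \<delta>..\<beta> - \<delta>}" "Im z = 0" "z \<noteq> of_real x0" for z
      using that boundary_value_real[OF reg[of z]] boundary_value_tendsto[OF reg[of z]] by simp
  qed (use B in simp)
qed

text \<open>Imaginary parts in the subordination relation give \<open>Im (\<omega> z)\<close> times
  one energy equal to \<open>Im z\<close> times the other, and \<open>Im (\<omega> z)\<close> is the
  larger factor.\<close>

lemma energy_le: "Im z > 0 \<Longrightarrow> cauchy_energy \<mu> (\<omega> z) \<le> cauchy_energy \<nu> z"
proof -
  assume z: "Im z > 0"
  then have w: "Im (\<omega> z) > 0" using Im_ge[of z] by simp
  have "Im (\<omega> z) * cauchy_energy \<mu> (\<omega> z) = Im z * cauchy_energy \<nu> z"
    using M.Im_cauchy_transform[OF w] N.Im_cauchy_transform[OF z] subord[OF z] by simp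
  also have "\<dots> \<le> Im (\<omega> z) * cauchy_energy \<nu> z"
    using Im_ge[OF z] N.cauchy_energy_pos[OF z] by (intro mult_right_mono) auto
  finally show ?thesis using w by simp
qed

lemma point_mass_of_equal_boundary_values:
  assumes eq: "f (of_real \<alpha>) = f (of_real \<beta>)"
  shows "\<mu> = return borel (Re (f (of_real \<alpha>)))"
proof -
  define a where "a = Re (f (of_real \<alpha>))"
  obtain x0 where x0: "\<alpha> < x0" "x0 < \<beta>" and zero: "cauchy_transform \<nu> (of_real x0) = 0"
    using N.cauchy_transform_zero_in_gap[OF less atom_\<alpha> atom_\<beta> gap] by metis
  define S where "S = {z. \<alpha> < Re z \<and> Re z < \<beta> \<and> \<bar>Im z\<bar> < 1}"
  define w where "w x = Re (f (of_real x))" for x :: real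
  have local_lipschitz: "\<exists>\<delta> C. \<delta> > 0 \<and> C > 0 \<and>
      x \<in> {\<alpha> + \<delta><..<\<beta> - \<delta>} \<and> x0 \<in> {\<alpha> + \<delta><..<\<beta> - \<delta>} \<and>
      (\<forall>z u. Re z \<in> {\<alpha> + \<delta>..\<beta> - \<delta>} \<longrightarrow> Im z \<in> {0..1} \<longrightarrow> z \<noteq> of_real x0 \<longrightarrow>
        Re u \<in> {\<alpha> + \<delta>..\<beta> - \<delta>} \<longrightarrow> Im u \<in> {0..1} \<longrightarrow> u \<noteq> of_real x0 \<longrightarrow>
        cmod (f z - f u) \<le> C * cmod (z - u) / (cmod (z - of_real x0) * cmod (u - of_real x0)))"
    if x: "\<alpha> < x" "x < \<beta>" for x
  proof -
    \<comment> \<open>Half the least distance to the ends, so that \<open>x\<close> and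
      \<open>x0\<close> both lie strictly inside the smaller interval.\<close>
    define \<delta> where "\<delta> = min (min (x - \<alpha>) (\<beta> - x)) (min (x0 - \<alpha>) (\<beta> - x0)) / 2"
    have \<delta>: "\<delta> > 0" "x \<in> {\<alpha> + \<delta><..<\<beta> - \<delta>}" "x0 \<in> {\<alpha> + \<delta><..<\<beta> - \<delta>}"
      using x x0 by (auto simp: \<delta>_def min_def field_simps)
    obtain C where "C > 0" and C: "\<And>z u. \<lbrakk>Re z \<in> {\<alpha> + \<delta>..\<beta> - \<delta>}; Im z \<in> {0..1}; z \<noteq> of_real x0;
        Re u \<in> {\<alpha> + \<delta>..\<beta> - \<delta>}; Im u \<in> {0..1}; u \<noteq> of_real x0\<rbrakk>
      \<Longrightarrow> cmod (f z - f u) \<le> C * cmod (z - u) / (cmod (z - of_real x0) * cmod (u - of_real x0))"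
      using gap_lipschitz[OF x0 zero \<delta>(1)] by metis
    show ?thesis
      by (rule exI[of _ \<delta>], rule exI[of _ C]) (use C \<delta> \<open>C > 0\<close> in blast)
  qed
  have on_line: "Im (f (of_real x)) = 0" "(\<lambda>n. \<omega> (above (of_real x) n)) \<longlonglongrightarrow> f (of_real x)"
    if x: "\<alpha> < x" "x < \<beta>" "x \<noteq> x0" for x
  proof -
    define \<delta> where "\<delta> = min (x - \<alpha>) (\<beta> - x)"
    have "\<delta> > 0" using x by (simp add: \<delta>_def)
    moreover have "Re (of_real x) \<in> {\<alpha> + \<delta>..\<beta> - \<delta>}" by (auto simp: \<delta>_def)
    ultimately show "Im (f (of_real x)) = 0" "(\<lambda>n. \<omega> (above (of_real x) n)) \<longlonglongrightarrow> f (of_real x)"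
      using gap_lipschitz[OF x0 zero, of \<delta>] x(3)
      by (metis Im_complex_of_real of_real_eq_iff)+
  qed
  have f_w: "f (of_real x) = of_real (w x)" if "\<alpha> < x" "x < \<beta>" "x \<noteq> x0" for x
    using on_line(1)[OF that] by (simp add: w_def complex_eq_iff)
  have f_\<omega>: "f z = \<omega> z" if "Im z > 0" for z using boundary_value_interior[OF hol that] .

  \<comment> \<open>Reflection makes \<open>w\<close> the restriction of a function analytic on a
    symmetric strip, with \<open>x0\<close> as its only possible singularity.\<close>
  define W where "W z = (if 0 \<le> Im z then f z else cnj (f (cnj z)))" for z
  have "open S" unfolding S_def
    by (intro open_Collect_conj open_Collect_less continuous_intros)
  have f_cont: "continuous_on ((S - {of_real x0}) \<inter> {z. 0 \<le> Im z}) f"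
  proof (rule continuous_on_eq_continuous_within[THEN iffD2], rule ballI)
    fix z assume z: "z \<in> (S - {of_real x0}) \<inter> {z. 0 \<le> Im z}"
    then have zx: "\<alpha> < Re z" "Re z < \<beta>" "Im z \<in> {0..1}" "z \<noteq> of_real x0" by (auto simp: S_def)
    obtain \<delta> C where \<delta>: "\<delta> > 0" "Re z \<in> {\<alpha> + \<delta><..<\<beta> - \<delta>}" and
      C: "\<And>z u. \<lbrakk>Re z \<in> {\<alpha> + \<delta>..\<beta> - \<delta>}; Im z \<in> {0..1}; z \<noteq> of_real x0;
        Re u \<in> {\<alpha> + \<delta>..\<beta> - \<delta>}; Im u \<in> {0..1}; u \<noteq> of_real x0\<rbrakk>
      \<Longrightarrow> cmod (f z - f u) \<le> C * cmod (z - u) / (cmod (z - of_real x0) * cmod (u - of_real x0))"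
      using local_lipschitz[OF zx(1,2)] by blast
    let ?A = "(S - {of_real x0}) \<inter> {z. 0 \<le> Im z}"
    have "((\<lambda>u. f u - f z) \<longlongrightarrow> 0) (at z within ?A)"
    proof (rule Lim_null_comparison)
      have "((\<lambda>u. C * cmod (u - z) / (cmod (u - of_real x0) * cmod (z - of_real x0)))
          \<longlongrightarrow> C * cmod (z - z) / (cmod (z - of_real x0) * cmod (z - of_real x0))) (at z within ?A)"
        using zx(4) by (intro tendsto_intros) auto
      then show "((\<lambda>u. C * cmod (u - z) / (cmod (u - of_real x0) * cmod (z - of_real x0))) \<longlongrightarrow> 0) (at z within ?A)"
        by simp
      have "\<forall>\<^sub>F u in at z within ?A. Re u \<in> {\<alpha> + \<delta><..<\<beta> - \<delta>}"
        by (rule topological_tendstoD[OF tendsto_Re[OF tendsto_ident_at]]) (use \<delta> in auto)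
      moreover have "\<forall>\<^sub>F u in at z within ?A. u \<in> ?A"
        by (simp add: eventually_at_filter)
      ultimately show "\<forall>\<^sub>F u in at z within ?A. norm (f u - f z) \<le> C * cmod (u - z) / (cmod (u - of_real x0) * cmod (z - of_real x0))"
      proof eventually_elim
        case (elim u)
        then show ?case using zx \<delta> by (intro C) (auto simp: S_def)
      qed
    qed
    then show "continuous (at z within ?A) f"
      unfolding continuous_within by (rule LIM_zero_cancel)
  qed
  have W_hol: "W holomorphic_on (S - {of_real x0})"
    unfolding W_def
  proof (rule Schwarz_reflection)
    show "open (S - {of_real x0})" using \<open>open S\<close> by blast
    show "cnj ` (S - {of_real x0}) \<subseteq> S - {of_real x0}" by (auto simp: S_def complex_eq_iff)
    have "\<omega> holomorphic_on (S - {of_real x0}) \<inter> {z. 0 < Im z}"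
      by (rule holomorphic_on_subset[OF hol]) auto
    then show "f holomorphic_on (S - {of_real x0}) \<inter> {z. 0 < Im z}"
      by (rule holomorphic_transform) (simp add: f_\<omega>)
    show "f z \<in> \<real>" if "z \<in> S - {of_real x0}" "z \<in> \<real>" for z
    proof -
      have "z = of_real (Re z)" using that(2) by (metis Re_complex_of_real Reals_cases)
      moreover have "\<alpha> < Re z" "Re z < \<beta>" "Re z \<noteq> x0" using that calculation by (auto simp: S_def)
      ultimately show ?thesis using f_w by (metis Reals_of_real)
    qed
  qed (rule f_cont)
  have W_real: "W (of_real x) = of_real (w x)" if "\<alpha> < x" "x < \<beta>" "x \<noteq> x0" for x
    using f_w[OF that] by (simp add: W_def)

  have of_real_lim: "filterlim complex_of_real (at (of_real x)) (at x)" for x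
    unfolding filterlim_at by (auto simp: eventually_at_filter intro!: tendsto_intros)
  \<comment> \<open>The complex derivative may be computed along the vertical direction. There
    \<open>W x\<close> is real and \<open>Im (\<omega> (x + \<i> h))\<close> is at least
    \<open>h\<close>, so the quotient has real part at least 1.\<close>
  have deriv: "\<exists>y. (w has_real_derivative y) (at x) \<and> y \<ge> 1" if x: "\<alpha> < x" "x < \<beta>" "x \<noteq> x0" for x
  proof -
    have xS: "of_real x \<in> S - {of_real x0}" using x by (auto simp: S_def)
    have "open (S - {of_real x0})" using \<open>open S\<close> by blast
    then obtain D where D: "(W has_field_derivative D) (at (of_real x))"
      using W_hol xS by (metis field_differentiable_def holomorphic_on_imp_differentiable_at)
    have "(\<lambda>h. (W (of_real x + h) - W (of_real x)) / h) \<midarrow>0\<rightarrow> D"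
      using D by (simp add: DERIV_def)
    moreover have "filterlim (\<lambda>n. \<i> * of_real (1 / real (Suc n))) (at 0) sequentially"
    proof (subst filterlim_at, intro conjI)
      show "\<forall>\<^sub>F n in sequentially. \<i> * of_real (1 / real (Suc n)) \<in> UNIV \<and> \<i> * complex_of_real (1 / real (Suc n)) \<noteq> 0"
        by (intro always_eventually) (simp del: of_nat_Suc)
      show "(\<lambda>n. \<i> * complex_of_real (1 / real (Suc n))) \<longlonglongrightarrow> 0"
        using shift_up_tendsto[of 0] by simp
    qed
    ultimately have "(\<lambda>n. (W (above (of_real x) n) - W (of_real x)) / (\<i> * of_real (1 / real (Suc n)))) \<longlonglongrightarrow> D"
      by (rule filterlim_compose)
    then have "(\<lambda>n. Re ((W (above (of_real x) n) - W (of_real x)) / (\<i> * of_real (1 / real (Suc n))))) \<longlonglongrightarrow> Re D"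
      by (rule tendsto_Re)
    moreover have "1 \<le> Re ((W (above (of_real x) n) - W (of_real x)) / (\<i> * of_real (1 / real (Suc n))))" for n
    proof -
      let ?h = "1 / real (Suc n)"
      have h: "?h > 0" by simp
      have pos: "Im (above (of_real x) n) > 0" by simp
      have "Re (z / (\<i> * of_real h)) = Im z / h" if "h \<noteq> 0" for z and h :: real
        using that by (simp add: Re_divide power2_eq_square)
      from this[of ?h "W (above (of_real x) n) - W (of_real x)"]
      have "Re ((W (above (of_real x) n) - W (of_real x)) / (\<i> * of_real ?h)) = Im (W (above (of_real x) n) - W (of_real x)) / ?h"
        using h by simp
      also have "Im (W (above (of_real x) n) - W (of_real x)) = Im (\<omega> (above (of_real x) n))"
        unfolding W_real[OF x] using pos by (simp add: W_def f_\<omega>)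
      also have "Im (\<omega> (above (of_real x) n)) / ?h \<ge> 1"
      proof -
        have "?h \<le> Im (\<omega> (above (of_real x) n))" using Im_ge[OF pos] by simp
        then show ?thesis using h by (simp only: pos_le_divide_eq mult_1)
      qed
      finally show ?thesis .
    qed
    ultimately have "1 \<le> Re D" by (intro LIMSEQ_le_const) auto
    moreover have "(w has_real_derivative Re D) (at x)"
    proof -
      have "((\<lambda>z. (W z - W (of_real x)) / (z - of_real x)) \<longlongrightarrow> D) (at (of_real x))"
        using D by (simp add: has_field_derivative_iff)
      then have "((\<lambda>t. Re ((W (of_real t) - W (of_real x)) / (of_real t - of_real x))) \<longlongrightarrow> Re D) (at x)"
        by (intro tendsto_Re filterlim_compose[OF _ of_real_lim])
      moreover have "\<forall>\<^sub>F t in at x. Re ((W (of_real t) - W (of_real x)) / (of_real t - of_real x)) = (w t - w x) / (t - x)"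
      proof -
        have "\<forall>\<^sub>F t in at x. t \<in> {\<alpha><..<\<beta>} - {x0}"
          using x by (intro eventually_at_in_open') auto
        then show ?thesis
        proof eventually_elim
          case (elim t)
          then have "(W (of_real t) - W (of_real x)) / (of_real t - of_real x) = of_real ((w t - w x) / (t - x))"
            using x by (simp add: W_real)
          then show ?case by (simp only: Re_complex_of_real)
        qed
      qed
      ultimately show ?thesis
        unfolding has_field_derivative_iff by (rule Lim_transform_eventually)
    qed
    ultimately show ?thesis by blast
  qed
  have incr: "y - x \<le> w y - w x" if "x \<le> y" "{x..y} \<subseteq> {\<alpha><..<\<beta>} - {x0}" for x y
  proof -
    have "(\<lambda>t. w t - t) x \<le> (\<lambda>t. w t - t) y"
    proof (rule DERIV_nonneg_imp_nondecreasing[OF that(1)])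
      fix t assume "x \<le> t" "t \<le> y"
      then have "\<alpha> < t" "t < \<beta>" "t \<noteq> x0" using that(2) by (auto simp: subset_iff)
      then obtain D where "(w has_real_derivative D) (at t)" "D \<ge> 1" using deriv by blast
      then show "\<exists>D. ((\<lambda>t. w t - t) has_real_derivative D) (at t) \<and> 0 \<le> D"
        by (intro exI[of _ "D - 1"]) (auto intro!: derivative_eq_intros)
    qed
    then show ?thesis by simp
  qed
  have w_cont: "continuous_on {x..y} w" if "{x..y} \<subseteq> {\<alpha><..<\<beta>} - {x0}" for x y
    using that deriv by (intro continuous_at_imp_continuous_on ballI) (metis DERIV_isCont DiffE greaterThanLessThan_iff singletonI subsetD)

  have pos_below: "\<exists>s>0. s < A \<and> s < B \<and> s < C" if "A > 0" "B > 0" "C > 0" for A B C :: real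
    by (rule exI[of _ "min A (min B C) / 2"]) (use that in \<open>auto simp: min_def\<close>)
  have near_\<alpha>: "\<exists>x. \<alpha> < x \<and> x < y \<and> \<bar>w x - a\<bar> < e" if "\<alpha> < y" "e > 0" for y e
  proof -
    let ?p = "measure \<nu> {\<alpha>}"
    have "y - \<alpha> > 0" "?p * (\<beta> - \<alpha>) / 4 > 0" "e / (4 / ?p)\<^sup>2 > 0" using that atom_\<alpha> less by auto
    then obtain s where s: "s > 0" "s < y - \<alpha>" "s < ?p * (\<beta> - \<alpha>) / 4" "s < e / (4 / ?p)\<^sup>2"
      using pos_below by metis
    have dist: "complex_of_real (\<alpha> + s) - of_real \<alpha> = of_real s" by simp
    have "cmod (f (of_real (\<alpha> + s)) - f (of_real \<alpha>)) \<le> (4 / ?p)\<^sup>2 * cmod (of_real (\<alpha> + s) - of_real \<alpha>)"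
      using s by (intro corner_lipschitz[of 1 \<alpha>]) (auto simp: dist simp del: of_real_add)
    also have "\<dots> = (4 / ?p)\<^sup>2 * s" unfolding dist using s by simp
    also have "\<dots> < e" using s(4) atom_\<alpha> by (simp add: pos_less_divide_eq mult.commute)
    finally have "cmod (f (of_real (\<alpha> + s)) - f (of_real \<alpha>)) < e" .
    then have "\<bar>w (\<alpha> + s) - a\<bar> < e"
      using abs_Re_le_cmod[of "f (of_real (\<alpha> + s)) - f (of_real \<alpha>)"] by (simp add: w_def a_def)
    then show ?thesis using s by (intro exI[of _ "\<alpha> + s"]) auto
  qed
  \<comment> \<open>The equality of the two boundary values enters here: near \<beta> the values of
    \<open>w\<close> approach the same \<open>a\<close> as near \<alpha>.\<close>
  have near_\<beta>: "\<exists>x. y < x \<and> x < \<beta> \<and> \<bar>w x - a\<bar> < e" if "y < \<beta>" "e > 0" for y e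
  proof -
    let ?p = "measure \<nu> {\<beta>}"
    have "\<beta> - y > 0" "?p * (\<beta> - \<alpha>) / 4 > 0" "e / (4 / ?p)\<^sup>2 > 0" using that atom_\<beta> less by auto
    then obtain s where s: "s > 0" "s < \<beta> - y" "s < ?p * (\<beta> - \<alpha>) / 4" "s < e / (4 / ?p)\<^sup>2"
      using pos_below by metis
    have dist: "complex_of_real (\<beta> - s) - of_real \<beta> = - of_real s" by simp
    have "cmod (f (of_real (\<beta> - s)) - f (of_real \<beta>)) \<le> (4 / ?p)\<^sup>2 * cmod (of_real (\<beta> - s) - of_real \<beta>)"
      using s by (intro corner_lipschitz[of "-1" \<beta>]) (auto simp: dist simp del: of_real_diff)
    also have "\<dots> = (4 / ?p)\<^sup>2 * s" unfolding dist using s by simp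
    also have "\<dots> < e" using s(4) atom_\<beta> by (simp add: pos_less_divide_eq mult.commute)
    finally have "cmod (f (of_real (\<beta> - s)) - f (of_real \<beta>)) < e" .
    then have "\<bar>w (\<beta> - s) - a\<bar> < e"
      using abs_Re_le_cmod[of "f (of_real (\<beta> - s)) - f (of_real \<beta>)"] eq by (simp add: w_def a_def)
    then show ?thesis using s by (intro exI[of _ "\<beta> - s"]) auto
  qed

  \<comment> \<open>Each value \<open>u\<close> in the interval is \<open>w t\<close> with
    \<open>t\<close> at distance at least \<delta> from almost all of \<nu>. The energy of \<nu>
    above \<open>t\<close> is thus at most \<open>1 / \<delta>\<^sup>2\<close>, and that of \<mu>
    along a sequence tending to \<open>u\<close> is no larger.\<close>
  have null: "measure \<mu> {p..q} = 0"
    if "p < q" and xy: "x \<le> y" "{x..y} \<subseteq> {\<alpha><..<\<beta>} - {x0}" "w x \<le> p" "q \<le> w y" for p q x y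
  proof (rule M.measure_Icc_eq_0[OF \<open>p < q\<close>])
    define \<delta> where "\<delta> = min (x - \<alpha>) (\<beta> - y)"
    have \<delta>: "\<delta> > 0" using xy(1,2) by (auto simp: \<delta>_def)
    fix u e :: real assume u: "p \<le> u" "u \<le> q" and "e > 0"
    obtain t where t: "x \<le> t" "t \<le> y" "w t = u"
      using IVT'[of w x u y] xy u w_cont[OF xy(2)] by auto
    then have tt: "\<alpha> < t" "t < \<beta>" "t \<noteq> x0" using xy(2) by (auto simp: subset_iff)
    show "measure \<mu> {u-e..u+e} \<le> 1 / \<delta>\<^sup>2 * e\<^sup>2"
    proof (rule M.measure_Icc_le_of_energy_bound)
      show "(\<lambda>n. \<omega> (above (of_real t) n)) \<longlonglongrightarrow> of_real u"
        using on_line(2)[OF tt] f_w[OF tt] t(3) by simp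
      show "Im (\<omega> (above (of_real t) n)) > 0" for n
        using Im_ge[of "above (of_real t) n"] by (simp add: less_le_trans[rotated])
      show "cauchy_energy \<mu> (\<omega> (above (of_real t) n)) \<le> 1 / \<delta>\<^sup>2" for n
      proof -
        have "AE s in \<nu>. \<delta> \<le> cmod (above (of_real t) n - of_real s)"
          using gap
        proof eventually_elim
          case (elim s)
          then have "\<delta> \<le> \<bar>t - s\<bar>" using t by (auto simp: \<delta>_def)
          then show ?case using abs_Re_le_cmod[of "above (of_real t) n - of_real s"] by simp
        qed
        then have "cauchy_energy \<nu> (above (of_real t) n) \<le> 1 / \<delta>\<^sup>2"
          using \<delta> by (rule N.integrable_cauchy_energy(2)[rotated])
        then show ?thesis using energy_le[of "above (of_real t) n"] by simp
      qed
    qed fact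
  qed

  obtain H where H: "H holomorphic_on S" "\<And>z. z \<in> S - {of_real x0} \<Longrightarrow> H z = (z - of_real x0) * W z"
  proof -
    have hol': "(\<lambda>z. (z - of_real x0) * W z) holomorphic_on (S - {of_real x0})"
      by (intro holomorphic_intros W_hol)
    have x0S: "of_real x0 \<in> interior S" using \<open>open S\<close> x0 by (simp add: interior_open S_def)
    obtain \<delta> C where \<delta>: "\<delta> > 0" "x0 \<in> {\<alpha> + \<delta><..<\<beta> - \<delta>}" and "C > 0" and
      C: "\<And>z u. \<lbrakk>Re z \<in> {\<alpha> + \<delta>..\<beta> - \<delta>}; Im z \<in> {0..1}; z \<noteq> of_real x0;
        Re u \<in> {\<alpha> + \<delta>..\<beta> - \<delta>}; Im u \<in> {0..1}; u \<noteq> of_real x0\<rbrakk>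
      \<Longrightarrow> cmod (f z - f u) \<le> C * cmod (z - u) / (cmod (z - of_real x0) * cmod (u - of_real x0))"
      using local_lipschitz[OF x0] by blast
    \<comment> \<open>A reference point at distance 1 from \<open>x0\<close>: against it the
      weighted Lipschitz bound says that |z - x0| |f z - f u| is bounded, so
      \<open>(z - x0) * W z\<close> has a removable singularity.\<close>
    define u where "u = of_real x0 + \<i>"
    have u: "Re u = x0" "Im u = 1" "u \<noteq> of_real x0" "cmod (u - of_real x0) = 1" by (auto simp: u_def)
    have fbd: "cmod (z - of_real x0) * cmod (f z) \<le> cmod (f u) + 2 * C"
      if z: "Re z \<in> {\<alpha> + \<delta><..<\<beta> - \<delta>}" "0 \<le> Im z" "cmod (z - of_real x0) < 1" "z \<noteq> of_real x0" for z
    proof -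
      let ?r = "cmod (z - of_real x0)"
      have r: "?r > 0" using z(4) by simp
      have "Im z \<le> 1" using abs_Im_le_cmod[of "z - of_real x0"] z(3) by simp
      then have "cmod (f z - f u) \<le> C * cmod (z - u) / (?r * cmod (u - of_real x0))"
        using z u \<delta> by (intro C) auto
      then have "?r * cmod (f z - f u) \<le> C * cmod (z - u)"
        using r u(4) by (simp add: pos_le_divide_eq mult.commute)
      also have "cmod (z - u) \<le> 2"
        using norm_triangle_ineq4[of "z - of_real x0" "u - of_real x0"] z(3) u(4) by simp
      finally have A: "?r * cmod (f z - f u) \<le> 2 * C" using \<open>C > 0\<close> by simp
      have "?r * cmod (f z) \<le> ?r * (cmod (f u) + cmod (f z - f u))"
        using norm_triangle_ineq[of "f u" "f z - f u"] r by (intro mult_left_mono) auto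
      also have "\<dots> \<le> 1 * cmod (f u) + 2 * C"
        unfolding distrib_left using A z(3) by (intro add_mono mult_right_mono) auto
      finally show ?thesis by simp
    qed
    have "\<forall>\<^sub>F z in at (of_real x0). Re z \<in> {\<alpha> + \<delta><..<\<beta> - \<delta>}"
      by (rule topological_tendstoD[OF tendsto_Re[OF tendsto_ident_at]]) (use \<delta> in auto)
    moreover have "\<forall>\<^sub>F z in at (complex_of_real x0). dist z (of_real x0) < 1"
      by (rule tendstoD[OF tendsto_ident_at]) simp
    moreover have "\<forall>\<^sub>F z in at (complex_of_real x0). z \<noteq> of_real x0" by (rule eventually_neq_at_within)
    ultimately have "\<forall>\<^sub>F z in at (of_real x0). cmod ((z - of_real x0) * W z) \<le> cmod (f u) + 2 * C"
    proof eventually_elim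
      case (elim z)
      show ?case
      proof (cases "0 \<le> Im z")
        case True
        then show ?thesis using fbd[of z] elim by (simp add: W_def norm_mult dist_norm)
      next
        case False
        have c: "cmod (cnj z - of_real x0) = cmod (z - of_real x0)"
          by (metis complex_cnj_complex_of_real complex_cnj_diff complex_mod_cnj)
        have "cnj z \<noteq> of_real x0" using elim(3) by (auto simp: complex_eq_iff)
        then show ?thesis using fbd[of "cnj z"] elim False by (simp add: W_def norm_mult dist_norm c)
      qed
    qed
    then show thesis using holomorphic_on_extend_bounded[OF hol' x0S] that by blast
  qed
  have x0S: "of_real x0 \<in> S" using x0 by (simp add: S_def)
  obtain D where D: "(H has_field_derivative D) (at (of_real x0))"
    using H(1) x0S \<open>open S\<close> by (metis field_differentiable_def holomorphic_on_imp_differentiable_at)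
  have seq_S: "of_real x \<in> S - {of_real x0}" if "\<alpha> < x" "x < \<beta>" "x \<noteq> x0" for x
    using that by (auto simp: S_def)
  have H_w: "H (of_real x) = of_real ((x - x0) * w x)" if "\<alpha> < x" "x < \<beta>" "x \<noteq> x0" for x
    using H(2)[OF seq_S[OF that]] W_real[OF that] by simp
  have ev: "\<forall>\<^sub>F x in at x0. \<alpha> < x \<and> x < \<beta> \<and> x \<noteq> x0"
  proof -
    have "\<forall>\<^sub>F x in at x0. x \<in> {\<alpha><..<\<beta>}" by (rule eventually_at_in_open') (use x0 in auto)
    then show ?thesis using eventually_neq_at_within[of x0] by eventually_elim auto
  qed
  \<comment> \<open>If this value were 0, \<open>w\<close> would have a finite limit at
    \<open>x0\<close> and increase with slope at least 1 across the whole gap, against the common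
    limit \<open>a\<close> at its ends.\<close>
  have "H (of_real x0) \<noteq> 0"
  proof
    assume H0: "H (of_real x0) = 0"
    have "((\<lambda>z. (H z - H (of_real x0)) / (z - of_real x0)) \<longlongrightarrow> D) (at (of_real x0))"
      using D by (simp add: has_field_derivative_iff)
    then have "((\<lambda>x. Re ((H (of_real x) - H (of_real x0)) / (of_real x - of_real x0))) \<longlongrightarrow> Re D) (at x0)"
      by (intro tendsto_Re filterlim_compose[OF _ of_real_lim])
    moreover have "\<forall>\<^sub>F x in at x0. Re ((H (of_real x) - H (of_real x0)) / (of_real x - of_real x0)) = w x"
      using ev
    proof eventually_elim
      case (elim x)
      then have "(H (of_real x) - H (of_real x0)) / (of_real x - of_real x0) = of_real (w x)"
        by (simp add: H_w H0)
      then show ?case by simp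
    qed
    ultimately have lim: "(w \<longlongrightarrow> Re D) (at x0)" by (simp add: filterlim_cong)
    have left: "w x + (x0 - x) \<le> Re D" if x: "\<alpha> < x" "x < x0" for x
    proof (rule tendsto_lowerbound)
      have "((\<lambda>t. w t - (t - x0)) \<longlongrightarrow> Re D - (x0 - x0)) (at_left x0)"
        using lim by (intro tendsto_intros tendsto_within_subset[OF lim]) auto
      then show "((\<lambda>t. w t - (t - x0)) \<longlongrightarrow> Re D) (at_left x0)" by simp
      have "\<forall>\<^sub>F t in at_left x0. t \<in> {x<..<x0}" using x(2) by (rule eventually_at_left_real)
      then show "\<forall>\<^sub>F t in at_left x0. w x + (x0 - x) \<le> w t - (t - x0)"
      proof eventually_elim
        case (elim t)
        then have "t - x \<le> w t - w x" using x x0 by (intro incr) auto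
        then show ?case by simp
      qed
    qed simp
    have right: "Re D \<le> w x - (x - x0)" if x: "x0 < x" "x < \<beta>" for x
    proof (rule tendsto_upperbound)
      have "((\<lambda>t. w t - (t - x0)) \<longlongrightarrow> Re D - (x0 - x0)) (at_right x0)"
        using lim by (intro tendsto_intros tendsto_within_subset[OF lim]) auto
      then show "((\<lambda>t. w t - (t - x0)) \<longlongrightarrow> Re D) (at_right x0)" by simp
      have "\<forall>\<^sub>F t in at_right x0. t \<in> {x0<..<x}" using x(1) by (rule eventually_at_right_real)
      then show "\<forall>\<^sub>F t in at_right x0. w t - (t - x0) \<le> w x - (x - x0)"
      proof eventually_elim
        case (elim t)
        then have "x - t \<le> w x - w t" using x x0 by (intro incr) auto
        then show ?case by simp
      qed
    qed simp
    let ?m = "(\<alpha> + x0) / 2"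
    \<comment> \<open>From a point left of \<open>?m\<close> to one right of \<open>x0\<close> the
      function would rise by more than \<open>x0 - ?m = 2 * e\<close>, although both values are
      within \<open>e\<close> of \<open>a\<close>.\<close>
    define e where "e = (x0 - ?m) / 2"
    have e: "e > 0" using x0 by (simp add: e_def)
    obtain x where x: "\<alpha> < x" "x < ?m" "\<bar>w x - a\<bar> < e" using near_\<alpha>[OF _ e, of ?m] x0 by auto
    obtain y where y: "x0 < y" "y < \<beta>" "\<bar>w y - a\<bar> < e" using near_\<beta>[OF x0(2) e] by auto
    have "x < x0" using x(2) x0 by simp
    then have "w x + (x0 - x) \<le> w y - (y - x0)" using left[of x] right[of y] x y by linarith
    moreover have "2 * e = x0 - ?m" by (simp add: e_def)
    ultimately show False using x(2,3) y(1,3) by linarith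
  qed
  then have H0: "cmod (H (of_real x0)) / 2 > 0" (is "?h > 0") by simp
  have large: "\<forall>\<^sub>F x in at x0. K < \<bar>w x\<bar>" for K
  proof -
    have "(H \<longlongrightarrow> H (of_real x0)) (at (of_real x0))"
      using DERIV_isCont[OF D] by (simp add: isCont_def)
    then have "((\<lambda>x. cmod (H (of_real x))) \<longlongrightarrow> cmod (H (of_real x0))) (at x0)"
      by (intro tendsto_norm filterlim_compose[OF _ of_real_lim])
    then have "\<forall>\<^sub>F x in at x0. ?h < cmod (H (of_real x))"
      by (rule order_tendstoD) (use H0 in simp)
    moreover have "\<forall>\<^sub>F x in at x0. dist x x0 < ?h / (\<bar>K\<bar> + 1)"
      by (rule tendstoD[OF tendsto_ident_at]) (use H0 in \<open>auto intro!: divide_pos_pos simp: add_nonneg_pos\<close>)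
    ultimately show ?thesis using ev
    proof eventually_elim
      case (elim x)
      have K1: "\<bar>K\<bar> + 1 > 0" by (simp add: add_nonneg_pos)
      have "cmod (H (of_real x)) = \<bar>x - x0\<bar> * \<bar>w x\<bar>"
        using H_w elim(3) by (metis abs_mult norm_of_real)
      then have "?h < \<bar>x - x0\<bar> * \<bar>w x\<bar>" using elim(1) by simp
      moreover have "\<bar>x - x0\<bar> * (\<bar>K\<bar> + 1) < ?h"
        using elim(2) K1 by (simp only: dist_real_def pos_less_divide_eq)
      ultimately have "\<bar>x - x0\<bar> * (\<bar>K\<bar> + 1) < \<bar>x - x0\<bar> * \<bar>w x\<bar>" by linarith
      then have "\<bar>K\<bar> + 1 < \<bar>w x\<bar>" using elim(3) by (simp add: mult_less_cancel_left)
      then show ?case by linarith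
    qed
  qed
  \<comment> \<open>Only |w| is known to be large near \<open>x0\<close>; the sign comes from
    monotonicity, as \<open>w y\<close> exceeds \<open>w x\<close> and |w y| exceeds |q| + |w x|.
    Hence \<open>w\<close> runs from near \<open>a\<close> up to infinity left of \<open>x0\<close>,
    and from minus infinity up to near \<open>a\<close> right of it.\<close>
  have right_null: "measure \<mu> {p..q} = 0" if ap: "a < p" and pq: "p < q" for p q
  proof -
    obtain x where x: "\<alpha> < x" "x < x0" "\<bar>w x - a\<bar> < p - a" using near_\<alpha>[OF x0(1), of "p - a"] ap by auto
    have "\<forall>\<^sub>F t in at_left x0. \<bar>q\<bar> + \<bar>w x\<bar> < \<bar>w t\<bar>"
      using large by (rule filter_leD[OF at_le[OF subset_UNIV]])
    moreover have "\<forall>\<^sub>F t in at_left x0. t \<in> {x<..<x0}" using x(2) by (rule eventually_at_left_real)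
    ultimately have "\<forall>\<^sub>F t in at_left x0. \<bar>q\<bar> + \<bar>w x\<bar> < \<bar>w t\<bar> \<and> t \<in> {x<..<x0}" by (rule eventually_conj)
    then obtain y where y: "\<bar>q\<bar> + \<bar>w x\<bar> < \<bar>w y\<bar>" "x < y" "y < x0"
      using eventually_happens'[OF trivial_limit_at_left_real] by fastforce
    have sub: "{x..y} \<subseteq> {\<alpha><..<\<beta>} - {x0}" using x y x0 by auto
    have "y - x \<le> w y - w x" using y sub by (intro incr) auto
    then have "q \<le> w y" using y by linarith
    moreover have "w x \<le> p" using x(3) by linarith
    ultimately show ?thesis using null[OF pq _ sub] y by simp
  qed
  have left_null: "measure \<mu> {p..q} = 0" if ap: "q < a" and pq: "p < q" for p q
  proof -
    obtain y where y: "x0 < y" "y < \<beta>" "\<bar>w y - a\<bar> < a - q" using near_\<beta>[OF x0(2), of "a - q"] ap by auto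
    have "\<forall>\<^sub>F t in at_right x0. \<bar>p\<bar> + \<bar>w y\<bar> < \<bar>w t\<bar>"
      using large by (rule filter_leD[OF at_le[OF subset_UNIV]])
    moreover have "\<forall>\<^sub>F t in at_right x0. t \<in> {x0<..<y}" using y(1) by (rule eventually_at_right_real)
    ultimately have "\<forall>\<^sub>F t in at_right x0. \<bar>p\<bar> + \<bar>w y\<bar> < \<bar>w t\<bar> \<and> t \<in> {x0<..<y}" by (rule eventually_conj)
    then obtain x where x: "\<bar>p\<bar> + \<bar>w y\<bar> < \<bar>w x\<bar>" "x < y" "x0 < x"
      using eventually_happens'[OF trivial_limit_at_right_real] by fastforce
    have sub: "{x..y} \<subseteq> {\<alpha><..<\<beta>} - {x0}" using x y x0 by auto
    have "y - x \<le> w y - w x" using x sub by (intro incr) auto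
    then have "w x \<le> p" using x by linarith
    moreover have "q \<le> w y" using y(3) by linarith
    ultimately show ?thesis using null[OF pq _ sub] x by simp
  qed

  have "AE t in \<mu>. t = a"
  proof -
    \<comment> \<open>Compact intervals that exhaust the complement of \<open>a\<close>; the summand
      2 keeps them nondegenerate even for \<open>n = 0\<close>.\<close>
    let ?R = "\<lambda>n::nat. {a + 1 / real (Suc n)..a + real n + 2}" and ?L = "\<lambda>n::nat. {a - real n - 2..a - 1 / real (Suc n)}"
    have "1 / real (Suc n) \<le> 1" for n by simp
    then have n: "1 / real (Suc n) < real n + 2" for n by (smt (verit) of_nat_0_le_iff)
    have "measure \<mu> (?R n) = 0" for n by (rule right_null) (use n[of n] in auto)
    moreover have "measure \<mu> (?L n) = 0" for n by (rule left_null) (use n[of n] in auto)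
    ultimately have "?R n \<in> null_sets \<mu>" "?L n \<in> null_sets \<mu>" for n
      by (auto intro!: null_setsI simp: M.emeasure_eq_measure)
    then have "AE t in \<mu>. t \<notin> ?R n \<and> t \<notin> ?L n" for n by (intro AE_conjI AE_not_in)
    then have "AE t in \<mu>. \<forall>n. t \<notin> ?R n \<and> t \<notin> ?L n" by (simp add: AE_all_countable)
    then show ?thesis
    proof eventually_elim
      case (elim t)
      show "t = a"
      proof (rule ccontr)
        assume "t \<noteq> a"
        obtain n1 :: nat where n1: "\<bar>t - a\<bar> < n1" using reals_Archimedean2 by blast
        obtain n2 where n2: "1 / real (Suc n2) < \<bar>t - a\<bar>" using reals_Archimedean[of "\<bar>t - a\<bar>"] \<open>t \<noteq> a\<close>
          by (auto simp: inverse_eq_divide)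
        have "1 / real (Suc (max n1 n2)) \<le> 1 / real (Suc n2)" by (intro divide_left_mono) auto
        then have "t \<in> ?R (max n1 n2) \<or> t \<in> ?L (max n1 n2)"
          using n1 n2 unfolding atLeastAtMost_iff abs_if by (auto split: if_splits)
        then show False using elim by blast
      qed
    qed
  qed
  have "\<mu> = return borel a"
  proof (rule measure_eqI)
    fix A assume A: "A \<in> sets \<mu>"
    have "emeasure \<mu> A = emeasure \<mu> (if a \<in> A then UNIV else {})"
      using \<open>AE t in \<mu>. t = a\<close> A by (intro emeasure_eq_AE) auto
    then show "emeasure \<mu> A = emeasure (return borel a) A"
      using A M.emeasure_space_1 by (auto simp: indicator_def)
  qed simp
  then show ?thesis by (simp add: a_def)
qed

end

section \<open>Comparison of the atoms of the two factors at the ends of the gap\<close>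

theorem theorem2p5:
  fixes \<mu>\<^sub>1 \<mu>\<^sub>2 \<nu> :: "real measure" and \<alpha> \<beta> :: real
  assumes "real_distribution \<mu>\<^sub>1" and "real_distribution \<mu>\<^sub>2"
    and "is_free_additive_convolution \<mu>\<^sub>1 \<mu>\<^sub>2 \<nu>"
    and "\<alpha> < \<beta>"
    and "measure \<nu> {\<alpha>} > 0" and "measure \<nu> {\<beta>} > 0"
    and "measure \<nu> {\<alpha><..<\<beta>} = 0"
  shows "is_point_mass \<mu>\<^sub>1 \<or> is_point_mass \<mu>\<^sub>2"
proof -
  interpret M1: real_distribution \<mu>\<^sub>1 by fact
  interpret M2: real_distribution \<mu>\<^sub>2 by fact
  interpret N: real_distribution \<nu> using assms(3) by (simp add: is_free_additive_convolution_def)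
  obtain \<omega>\<^sub>1 \<omega>\<^sub>2 where hol: "\<omega>\<^sub>1 holomorphic_on {z. Im z > 0}" "\<omega>\<^sub>2 holomorphic_on {z. Im z > 0}"
    and ge: "\<And>z. Im z > 0 \<Longrightarrow> Im z \<le> Im (\<omega>\<^sub>1 z)" "\<And>z. Im z > 0 \<Longrightarrow> Im z \<le> Im (\<omega>\<^sub>2 z)"
    and sub: "\<And>z. Im z > 0 \<Longrightarrow> cauchy_transform \<mu>\<^sub>1 (\<omega>\<^sub>1 z) = cauchy_transform \<nu> z"
      "\<And>z. Im z > 0 \<Longrightarrow> cauchy_transform \<mu>\<^sub>2 (\<omega>\<^sub>2 z) = cauchy_transform \<nu> z"
    and sum: "\<And>z. Im z > 0 \<Longrightarrow> \<omega>\<^sub>1 z + \<omega>\<^sub>2 z = z + 1 / cauchy_transform \<nu> z"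
    by (rule subordination[OF assms(1-3)]) (rule that)
  have Im_sum: "Im (\<omega>\<^sub>1 z) + Im (\<omega>\<^sub>2 z) = Im z + Im (1 / cauchy_transform \<nu> z)" if "Im z > 0" for z
    using arg_cong[OF sum[OF that], of Im] by simp
  have gap: "AE t in \<nu>. t \<le> \<alpha> \<or> \<beta> \<le> t"
  proof -
    have "{\<alpha><..<\<beta>} \<in> null_sets \<nu>" using assms(7) by (auto intro!: null_setsI simp: N.emeasure_eq_measure)
    then have "AE t in \<nu>. t \<notin> {\<alpha><..<\<beta>}" by (rule AE_not_in)
    then show ?thesis by eventually_elim auto
  qed
  interpret S1: gap_subordination \<nu> \<mu>\<^sub>1 \<omega>\<^sub>1 \<alpha> \<beta>
  proof
    show "Im (\<omega>\<^sub>1 z) \<le> Im (1 / cauchy_transform \<nu> z)" if "Im z > 0" for z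
      using Im_sum[OF that] ge(2)[OF that] by linarith
  qed (use assms gap hol ge sub in auto)
  interpret S2: gap_subordination \<nu> \<mu>\<^sub>2 \<omega>\<^sub>2 \<alpha> \<beta>
  proof
    show "Im (\<omega>\<^sub>2 z) \<le> Im (1 / cauchy_transform \<nu> z)" if "Im z > 0" for z
      using Im_sum[OF that] ge(1)[OF that] by linarith
  qed (use assms gap hol ge sub in auto)
  define a where "a \<gamma> = Re (boundary_value \<omega>\<^sub>1 (of_real \<gamma>))" for \<gamma> :: real
  define b where "b \<gamma> = Re (boundary_value \<omega>\<^sub>2 (of_real \<gamma>))" for \<gamma> :: real
  have corner: "boundary_value \<omega>\<^sub>1 (of_real \<gamma>) = of_real (a \<gamma>) \<and> boundary_value \<omega>\<^sub>2 (of_real \<gamma>) = of_real (b \<gamma>)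
      \<and> a \<gamma> + b \<gamma> = \<gamma> \<and> measure \<mu>\<^sub>1 {a \<gamma>} + measure \<mu>\<^sub>2 {b \<gamma>} = 1 + measure \<nu> {\<gamma>}"
    if \<sigma>: "(\<sigma>, \<gamma>) \<in> {(1, \<alpha>), (-1, \<beta>)}" for \<sigma> \<gamma> :: real
  proof -
    let ?z = "\<lambda>n. complex_of_real \<gamma> + \<i> * of_real (1 / real (Suc n))" and ?G = "cauchy_transform \<nu>"
    have pos: "Im (?z n) > 0" for n by simp
    have A: "boundary_value \<omega>\<^sub>1 (of_real \<gamma>) = of_real (a \<gamma>)" and B: "boundary_value \<omega>\<^sub>2 (of_real \<gamma>) = of_real (b \<gamma>)"
      using S1.corner_real[OF \<sigma>] S2.corner_real[OF \<sigma>] by (auto simp: a_def b_def complex_eq_iff)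
    have "(\<lambda>n. \<omega>\<^sub>1 (?z n) + \<omega>\<^sub>2 (?z n)) \<longlonglongrightarrow> of_real (a \<gamma>) + of_real (b \<gamma>)"
      using S1.corner_tendsto[OF \<sigma>] S2.corner_tendsto[OF \<sigma>] unfolding A B by (rule tendsto_add)
    moreover have "(\<lambda>n. ?z n + 1 / ?G (?z n)) \<longlonglongrightarrow> of_real \<gamma> + 0"
      using shift_up_tendsto S1.corner_inverse[OF \<sigma>] by (rule tendsto_add)
    ultimately have "complex_of_real (a \<gamma>) + of_real (b \<gamma>) = of_real \<gamma> + 0"
      unfolding sum[OF pos] by (rule LIMSEQ_unique)
    then have ab: "a \<gamma> + b \<gamma> = \<gamma>" by (metis add.right_neutral of_real_add of_real_eq_iff)
    have "(\<lambda>n. (\<omega>\<^sub>1 (?z n) - of_real (a \<gamma>)) * ?G (?z n) + (\<omega>\<^sub>2 (?z n) - of_real (b \<gamma>)) * ?G (?z n))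
        \<longlonglongrightarrow> of_real (measure \<mu>\<^sub>1 {a \<gamma>}) + of_real (measure \<mu>\<^sub>2 {b \<gamma>})"
      using S1.corner_atom[OF \<sigma>] S2.corner_atom[OF \<sigma>] unfolding A B Re_complex_of_real by (rule tendsto_add)
    \<comment> \<open>The sum relation times \<open>?G\<close>, with
      \<open>a \<gamma> + b \<gamma> = \<gamma>\<close>. The product of \<open>1 / ?G\<close> and
      \<open>?G\<close> is the source of the 1 in the mass relation.\<close>
    moreover have "(\<omega>\<^sub>1 (?z n) - of_real (a \<gamma>)) * ?G (?z n) + (\<omega>\<^sub>2 (?z n) - of_real (b \<gamma>)) * ?G (?z n)
        = (?z n - of_real \<gamma>) * ?G (?z n) + 1" for n
    proof -
      have "(\<omega>\<^sub>1 (?z n) - of_real (a \<gamma>)) * ?G (?z n) + (\<omega>\<^sub>2 (?z n) - of_real (b \<gamma>)) * ?G (?z n)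
        = ((\<omega>\<^sub>1 (?z n) + \<omega>\<^sub>2 (?z n)) - of_real (a \<gamma> + b \<gamma>)) * ?G (?z n)"
        by (simp add: algebra_simps)
      also have "\<dots> = (?z n - of_real \<gamma>) * ?G (?z n) + 1 / ?G (?z n) * ?G (?z n)"
      proof -
        have "(z + y - g) * G = (z - g) * G + y * G" for z y g G :: complex by (simp add: algebra_simps)
        then show ?thesis unfolding sum[OF pos] ab .
      qed
      also have "1 / ?G (?z n) * ?G (?z n) = 1" using N.cauchy_transform_nonzero[OF pos] by simp
      finally show ?thesis .
    qed
    moreover have "(\<lambda>n. (?z n - of_real \<gamma>) * ?G (?z n) + 1) \<longlonglongrightarrow> of_real (measure \<nu> {\<gamma>}) + 1"
      using S1.corner_mass[OF \<sigma>] tendsto_const by (rule tendsto_add)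
    ultimately have "complex_of_real (measure \<mu>\<^sub>1 {a \<gamma>}) + of_real (measure \<mu>\<^sub>2 {b \<gamma>}) = of_real (measure \<nu> {\<gamma>}) + 1"
      by (simp only: LIMSEQ_unique)
    then have "measure \<mu>\<^sub>1 {a \<gamma>} + measure \<mu>\<^sub>2 {b \<gamma>} = 1 + measure \<nu> {\<gamma>}"
      by (metis add.commute of_real_1 of_real_add of_real_eq_iff)
    then show ?thesis using A B ab by simp
  qed
  note c\<alpha> = corner[of 1 \<alpha>, simplified] and c\<beta> = corner[of "-1" \<beta>, simplified]
  have two: "measure M {x} + measure M {y} \<le> 1" if "real_distribution M" "x \<noteq> y" for M :: "real measure" and x y
  proof -
    interpret real_distribution M by fact
    have "measure M ({x} \<union> {y}) = measure M {x} + measure M {y}"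
      using that(2) by (intro finite_measure_Union) auto
    then show ?thesis using prob_le_1[of "{x} \<union> {y}"] by simp
  qed
  \<comment> \<open>If both pairs were distinct, adding the mass relations at \<alpha> and \<beta>
    would give 2 plus the masses of two atoms of \<nu>, yet the total mass available is 2.\<close>
  have "a \<alpha> = a \<beta> \<or> b \<alpha> = b \<beta>"
  proof (rule ccontr)
    assume "\<not> ?thesis"
    then have "measure \<mu>\<^sub>1 {a \<alpha>} + measure \<mu>\<^sub>1 {a \<beta>} \<le> 1" "measure \<mu>\<^sub>2 {b \<alpha>} + measure \<mu>\<^sub>2 {b \<beta>} \<le> 1"
      using two assms(1,2) by blast+
    then show False using c\<alpha> c\<beta> assms(5,6) by linarith
  qed
  then show ?thesis
  proof
    assume "a \<alpha> = a \<beta>"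
    then have "boundary_value \<omega>\<^sub>1 (of_real \<alpha>) = boundary_value \<omega>\<^sub>1 (of_real \<beta>)" using c\<alpha> c\<beta> by simp
    then show ?thesis unfolding is_point_mass_def by (blast dest: S1.point_mass_of_equal_boundary_values)
  next
    assume "b \<alpha> = b \<beta>"
    then have "boundary_value \<omega>\<^sub>2 (of_real \<alpha>) = boundary_value \<omega>\<^sub>2 (of_real \<beta>)" using c\<alpha> c\<beta> by simp
    then show ?thesis unfolding is_point_mass_def by (blast dest: S2.point_mass_of_equal_boundary_values)
  qed
qed

end
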